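(* (Construction of an orthonormal normal frame.) At each point of $\Sigma$, let $E_\alpha$ (with components $E_\alpha^\beta$) be orthonormal eigenvectors of the matrix $\mathcal{Z}$ with entries $\mathcal{Z}_\alpha^\beta=\bar g(Z_\alpha,Z^\beta)$, where orthonormal means $\bar g_{\delta\sigma}E_\alpha^\delta E_\beta^\sigma=\delta_{\alpha\beta}$, and define $\hat N_\alpha=E_\alpha^\beta Z_\beta$. Then exactly $p$ of the vectors $\hat N_\alpha$ are non-zero, and these $p$ non-zero vectors constitute an orthonormal basis of $T\Sigma^\perp$.
   Context: Setting: $n\ge 2$, $p\ge1$, $\Sigma$ is an $n$-dimensional manifold embedded in a Riemannian manifold $(M,\bar g)$ with $\dim M=m=n+p$. $x^1,\dots,x^m$ are local coordinates on $M$, $u^1,\dots,u^n$ local coordinates on $\Sigma$; the $x^i$ are regarded as functions of the $u^a$ (the embedding), and $\partial_a=\partial/\partial u^a$. Repeated indices and multi-indices are summed. $e_a=(\partial_ax^i)\partial_i$ is the basis of $T\Sigma\subset TM$, $g_{ab}=\bar g(e_a,e_b)$, $g=\det(g_{ab})$. $\rho$ is an arbitrary non-vanishing density on $\Sigma$, $\{f_1,\dots,f_n\}=\frac1\rho\varepsilon^{a_1\cdots a_n}(\partial_{a_1}f_1)\cdots(\partial_{a_n}f_n)$ with $\varepsilon^{a_1\cdots a_n}$ the Levi-Civita symbol ($\varepsilon^{12\cdots n}=1$), and $\gamma=\sqrt g/\rho$. $\alpha=i_1\cdots i_{p-1}$ denotes a multi-index of $p-1$ indices each running from $1$ to $m$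 (empty if $p=1$), and $$Z_\alpha=\frac{1}{\gamma\,n!\sqrt{(p-1)!}}\,\bar g^{ij}\varepsilon_{jk_1\cdots k_n\alpha}\{x^{k_1},\dots,x^{k_n}\}\,\partial_i,$$ where $\varepsilon_{i_1\cdots i_m}$ is the Levi-Civita tensor of $M$ (the Riemannian volume form, $\varepsilon_{1\cdots m}=\sqrt{\det\bar g}$). Multi-indices are lowered and raised with $\bar g_{\alpha\beta}=\bar g_{i_1j_1}\cdots\bar g_{i_{p-1}j_{p-1}}$ and its inverse. The matrix $\mathcal{Z}$ is symmetric with respect to $\bar g_{\alpha\beta}$. The label $\alpha$ on the eigenvectors $E_\alpha$ enumerates them and ranges over as many values as there are multi-indices. *)

theory Defs
  imports "HOL-Analysis.Analysis"
begin

section \<open>Smooth manifolds, Riemannian metrics, embeddings, densities\<close>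

text \<open>Writing \<open>real^'n\<close> for a variable \<open>'n\<close> forces the sort \<open>finite\<close> exactly, which would exclude
  index types that are also linearly ordered.\<close>

type_synonym 'n rvec = "real^'n"
type_synonym 'n rmat = "real^'n^'n"

definition partial :: "'n::finite \<Rightarrow> ('n rvec \<Rightarrow> 'b::real_normed_vector) \<Rightarrow> 'n rvec \<Rightarrow> 'b" where
  "partial a f u = frechet_derivative f (at u) (axis a 1)"

text \<open>Intended for open sets: the derivatives are two-sided ones, \<open>at x\<close>.\<close>

primrec Ck_on :: "nat \<Rightarrow> 'n::finite rvec set \<Rightarrow> ('n rvec \<Rightarrow> 'b::real_normed_vector) \<Rightarrow> bool" where
  "Ck_on 0 U f \<longleftrightarrow> continuous_on U f"
| "Ck_on (Suc k) U f \<longleftrightarrow> (\<forall>x\<in>U. f differentiable (at x)) \<and> (\<forall>a. Ck_on k U (partial a f))"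

definition smooth_on :: "'n::finite rvec set \<Rightarrow> ('n rvec \<Rightarrow> 'b::real_normed_vector) \<Rightarrow> bool" where
  "smooth_on U f \<longleftrightarrow> (\<forall>k. Ck_on k U f)"

definition jacobian :: "('n::finite rvec \<Rightarrow> 'k::finite rvec) \<Rightarrow> 'n rvec \<Rightarrow> real^'n^'k" where
  "jacobian f u = matrix (frechet_derivative f (at u))"

text \<open>A chart is its domain together with its coordinate map; the coordinate map is meaningless
  outside the domain.\<close>

type_synonym ('a, 'n) chart = "'a set \<times> ('a \<Rightarrow> 'n rvec)"

abbreviation dom_chart :: "('a, 'n) chart \<Rightarrow> 'a set" where
  "dom_chart c \<equiv> fst c"

abbreviation coords :: "('a, 'n) chart \<Rightarrow> 'a \<Rightarrow> 'n rvec" where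
  "coords c \<equiv> snd c"

definition param :: "('a, 'n) chart \<Rightarrow> 'n rvec \<Rightarrow> 'a" where
  "param c = inv_into (dom_chart c) (coords c)"

definition chart_on :: "'a topology \<Rightarrow> ('a, 'n::finite) chart \<Rightarrow> bool" where
  "chart_on X c \<longleftrightarrow>
     openin X (dom_chart c) \<and> open (coords c ` dom_chart c) \<and>
     homeomorphic_map (subtopology X (dom_chart c)) (top_of_set (coords c ` dom_chart c)) (coords c)"

definition transition :: "('a, 'n) chart \<Rightarrow> ('a, 'n) chart \<Rightarrow> 'n rvec \<Rightarrow> 'n rvec" where
  "transition c c' = coords c' \<circ> param c"

definition overlap :: "('a, 'n) chart \<Rightarrow> ('a, 'n) chart \<Rightarrow> 'n rvec set" where
  "overlap c c' = coords c ` (dom_chart c \<inter> dom_chart c')"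

definition smooth_manifold :: "'a topology \<Rightarrow> ('a, 'n::finite) chart set \<Rightarrow> bool" where
  "smooth_manifold X \<A> \<longleftrightarrow>
     Hausdorff_space X \<and> second_countable X \<and>
     (\<forall>c\<in>\<A>. chart_on X c) \<and> (\<Union>c\<in>\<A>. dom_chart c) = topspace X \<and>
     (\<forall>c\<in>\<A>. \<forall>c'\<in>\<A>. smooth_on (overlap c c') (transition c c'))"

text \<open>A tensor field is given by its components in each chart, subject to the
  transformation law: for a metric \<open>h\<close>, the matrix \<open>h c x\<close> is \<open>(h\<^sub>i\<^sub>j)\<close> at the point
  with coordinates \<open>x\<close> in the chart \<open>c\<close>.\<close>

definition riemannian_metric ::
  "('a, 'm::finite) chart set \<Rightarrow> (('a, 'm) chart \<Rightarrow> 'm rvec \<Rightarrow> 'm rmat) \<Rightarrow> bool" where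
  "riemannian_metric \<A> h \<longleftrightarrow>
     (\<forall>c\<in>\<A>. smooth_on (coords c ` dom_chart c) (h c) \<and>
        (\<forall>x\<in>coords c ` dom_chart c.
           transpose (h c x) = h c x \<and> (\<forall>v. v \<noteq> 0 \<longrightarrow> v \<bullet> (h c x *v v) > 0))) \<and>
     (\<forall>c\<in>\<A>. \<forall>c'\<in>\<A>. \<forall>x\<in>overlap c c'.
        h c x = transpose (jacobian (transition c c') x) **
                h c' (transition c c' x) ** jacobian (transition c c') x)"

definition nonvanishing_density ::
  "('b, 'n::finite) chart set \<Rightarrow> (('b, 'n) chart \<Rightarrow> 'n rvec \<Rightarrow> real) \<Rightarrow> bool" where
  "nonvanishing_density \<B> \<rho> \<longleftrightarrow>
     (\<forall>c\<in>\<B>. \<forall>u\<in>coords c ` dom_chart c. \<rho> c u \<noteq> 0) \<and>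
     (\<forall>c\<in>\<B>. \<forall>c'\<in>\<B>. \<forall>u\<in>overlap c c'.
        \<rho> c u = \<bar>det (jacobian (transition c c') u)\<bar> * \<rho> c' (transition c c' u))"

text \<open>The coordinates \<open>x\<^sup>i\<close> of the ambient chart \<open>d\<close> as functions of the coordinates \<open>u\<^sup>a\<close> of
  the chart \<open>c\<close> of the submanifold.\<close>

definition local_rep ::
  "('b \<Rightarrow> 'a) \<Rightarrow> ('b, 'n) chart \<Rightarrow> ('a, 'm) chart \<Rightarrow> 'n rvec \<Rightarrow> 'm rvec" where
  "local_rep \<iota> c d = coords d \<circ> \<iota> \<circ> param c"

definition smooth_embedding ::
  "'b topology \<Rightarrow> ('b, 'n::finite) chart set \<Rightarrow> 'a topology \<Rightarrow> ('a, 'm::finite) chart set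
     \<Rightarrow> ('b \<Rightarrow> 'a) \<Rightarrow> bool" where
  "smooth_embedding Y \<B> X \<A> \<iota> \<longleftrightarrow>
     embedding_map Y X \<iota> \<and>
     (\<forall>c\<in>\<B>. \<forall>d\<in>\<A>. let U = coords c ` {q \<in> dom_chart c. \<iota> q \<in> dom_chart d} in
        smooth_on U (local_rep \<iota> c d) \<and>
        (\<forall>u\<in>U. inj (frechet_derivative (local_rep \<iota> c d) (at u))))"

section \<open>Pointwise tensor calculus in coordinates\<close>

text \<open>Tangent vectors of the ambient manifold are represented by their components with respect to
  \<open>\<partial>\<^sub>i\<close>. The linear order on the index type plays the role of the order of the labels
  \<open>1, \<dots>, m\<close>. Below, \<open>G\<close> is the matrix of the ambient metric at the point under consideration,
  \<open>x\<close> the coordinate expression of the embedding, \<open>r\<close> that of the density.\<close>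

definition metric_inner :: "'m rmat \<Rightarrow> 'm::finite rvec \<Rightarrow> 'm rvec \<Rightarrow> real" where
  "metric_inner G v w = (\<Sum>i\<in>UNIV. \<Sum>j\<in>UNIV. G $ i $ j * v $ i * w $ j)"

definition frame :: "('n::finite rvec \<Rightarrow> 'm::finite rvec) \<Rightarrow> 'n rvec \<Rightarrow> 'n \<Rightarrow> 'm rvec" where
  "frame x u a = (\<chi> i. partial a (\<lambda>u. x u $ i) u)"

definition tangent_space :: "('n::finite rvec \<Rightarrow> 'm::finite rvec) \<Rightarrow> 'n rvec \<Rightarrow> 'm rvec set" where
  "tangent_space x u = span (range (frame x u))"

definition normal_vectors ::
  "'m rmat \<Rightarrow> ('n::finite rvec \<Rightarrow> 'm::finite rvec) \<Rightarrow> 'n rvec \<Rightarrow> 'm rvec set" where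
  "normal_vectors G x u = {v. \<forall>w\<in>tangent_space x u. metric_inner G v w = 0}"

definition induced_metric ::
  "'m rmat \<Rightarrow> ('n::finite rvec \<Rightarrow> 'm::finite rvec) \<Rightarrow> 'n rvec \<Rightarrow> 'n rmat" where
  "induced_metric G x u = (\<chi> a b. metric_inner G (frame x u a) (frame x u b))"

definition gamma_factor ::
  "'m rmat \<Rightarrow> ('n::finite rvec \<Rightarrow> 'm::finite rvec) \<Rightarrow> ('n rvec \<Rightarrow> real) \<Rightarrow> 'n rvec \<Rightarrow> real" where
  "gamma_factor G x r u = sqrt (det (induced_metric G x u)) / r u"

text \<open>If the list enumerates all indices, the permutation below sends the \<open>k\<close>-th smallest index to
  the \<open>k\<close>-th entry of the list.\<close>

definition levi_civita_symbol :: "'i::{finite,linorder} list \<Rightarrow> real" where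
  "levi_civita_symbol l =
     (if distinct l \<and> set l = UNIV then of_int (sign (\<lambda>i. l ! card {j. j < i})) else 0)"

definition levi_civita_tensor :: "'m rmat \<Rightarrow> 'm::{finite,linorder} list \<Rightarrow> real" where
  "levi_civita_tensor G l = sqrt (det G) * levi_civita_symbol l"

definition multibracket ::
  "('n rvec \<Rightarrow> real) \<Rightarrow> ('n::{finite,linorder} rvec \<Rightarrow> real) list \<Rightarrow> 'n rvec \<Rightarrow> real" where
  "multibracket r fs u =
     1 / r u * (\<Sum>l | length l = CARD('n).
       levi_civita_symbol l * (\<Prod>k<CARD('n). partial (l ! k) (fs ! k) u))"

definition multi_indices :: "nat \<Rightarrow> 'm list set" where
  "multi_indices p = {\<alpha>. length \<alpha> = p - 1}"

text \<open>\<open>multi_metric G \<alpha> \<beta>\<close> lowers multi-indices, \<open>multi_metric (matrix_inv G) \<alpha> \<beta>\<close> raises them.\<close>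

definition multi_metric :: "'m rmat \<Rightarrow> 'm::finite list \<Rightarrow> 'm list \<Rightarrow> real" where
  "multi_metric G \<alpha> \<beta> = (\<Prod>k<length \<alpha>. G $ (\<alpha> ! k) $ (\<beta> ! k))"

definition Z_lower ::
  "nat \<Rightarrow> 'm rmat \<Rightarrow> ('n::{finite,linorder} rvec \<Rightarrow> 'm::{finite,linorder} rvec) \<Rightarrow>
     ('n rvec \<Rightarrow> real) \<Rightarrow> 'n rvec \<Rightarrow> 'm list \<Rightarrow> 'm rvec" where
  "Z_lower p G x r u \<alpha> = (\<chi> i.
     1 / (gamma_factor G x r u * fact CARD('n) * sqrt (fact (p - 1))) *
     (\<Sum>j\<in>UNIV. \<Sum>ks | length ks = CARD('n).
        matrix_inv G $ i $ j * levi_civita_tensor G (j # ks @ \<alpha>) *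
        multibracket r (map (\<lambda>k u. x u $ k) ks) u))"

definition Z_upper ::
  "nat \<Rightarrow> 'm rmat \<Rightarrow> ('n::{finite,linorder} rvec \<Rightarrow> 'm::{finite,linorder} rvec) \<Rightarrow>
     ('n rvec \<Rightarrow> real) \<Rightarrow> 'n rvec \<Rightarrow> 'm list \<Rightarrow> 'm rvec" where
  "Z_upper p G x r u \<beta> =
     (\<Sum>\<delta>\<in>multi_indices p. multi_metric (matrix_inv G) \<beta> \<delta> *\<^sub>R Z_lower p G x r u \<delta>)"

text \<open>\<open>Z_matrix p G x r u \<alpha> \<beta>\<close> is the entry with lower index \<open>\<alpha>\<close> and upper index \<open>\<beta>\<close>.\<close>

definition Z_matrix ::
  "nat \<Rightarrow> 'm rmat \<Rightarrow> ('n::{finite,linorder} rvec \<Rightarrow> 'm::{finite,linorder} rvec) \<Rightarrow>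
     ('n rvec \<Rightarrow> real) \<Rightarrow> 'n rvec \<Rightarrow> 'm list \<Rightarrow> 'm list \<Rightarrow> real" where
  "Z_matrix p G x r u \<alpha> \<beta> = metric_inner G (Z_lower p G x r u \<alpha>) (Z_upper p G x r u \<beta>)"

text \<open>The components of an eigenvector carry an upper multi-index, so the matrix acts by
  contraction over its lower index.\<close>

definition multi_eigenvector :: "nat \<Rightarrow> ('m list \<Rightarrow> 'm list \<Rightarrow> real) \<Rightarrow> ('m list \<Rightarrow> real) \<Rightarrow> bool" where
  "multi_eigenvector p A e \<longleftrightarrow>
     (\<exists>\<beta>\<in>multi_indices p. e \<beta> \<noteq> 0) \<and>
     (\<exists>\<mu>. \<forall>\<beta>\<in>multi_indices p. (\<Sum>\<alpha>\<in>multi_indices p. A \<alpha> \<beta> * e \<alpha>) = \<mu> * e \<beta>)"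

text \<open>\<open>E \<alpha> \<beta>\<close> is the component with upper index \<open>\<beta>\<close> of the vector with label \<open>\<alpha>\<close>.\<close>

definition multi_orthonormal :: "nat \<Rightarrow> 'm rmat \<Rightarrow> ('m::finite list \<Rightarrow> 'm list \<Rightarrow> real) \<Rightarrow> bool" where
  "multi_orthonormal p G E \<longleftrightarrow>
     (\<forall>\<alpha>\<in>multi_indices p. \<forall>\<beta>\<in>multi_indices p.
        (\<Sum>\<delta>\<in>multi_indices p. \<Sum>\<sigma>\<in>multi_indices p. multi_metric G \<delta> \<sigma> * E \<alpha> \<delta> * E \<beta> \<sigma>) =
        (if \<alpha> = \<beta> then 1 else 0))"

definition N_hat ::
  "nat \<Rightarrow> 'm rmat \<Rightarrow> ('n::{finite,linorder} rvec \<Rightarrow> 'm::{finite,linorder} rvec) \<Rightarrow>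
     ('n rvec \<Rightarrow> real) \<Rightarrow> 'n rvec \<Rightarrow> ('m list \<Rightarrow> 'm list \<Rightarrow> real) \<Rightarrow> 'm list \<Rightarrow> 'm rvec" where
  "N_hat p G x r u E \<alpha> = (\<Sum>\<beta>\<in>multi_indices p. E \<alpha> \<beta> *\<^sub>R Z_lower p G x r u \<beta>)"

definition orthonormal_basis_of ::
  "'m rmat \<Rightarrow> 'm::finite rvec set \<Rightarrow> 'i set \<Rightarrow> ('i \<Rightarrow> 'm rvec) \<Rightarrow> bool" where
  "orthonormal_basis_of G W I v \<longleftrightarrow>
     (\<forall>i\<in>I. \<forall>j\<in>I. metric_inner G (v i) (v j) = (if i = j then 1 else 0)) \<and>
     independent (v ` I) \<and> span (v ` I) = W"

end

theory Submission
  imports Defs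
begin

text \<open>
  Everything happens at one point. Write \<open>e\<^sub>1, \<dots>, e\<^sub>n\<close> for the tangent frame, \<open>g\<close> for its Gram
  matrix and \<open>det (v\<^sub>1, \<dots>, v\<^sub>m)\<close> for the determinant of the matrix with rows \<open>v\<^sub>1, \<dots>, v\<^sub>m\<close>.
  The bracket antisymmetrises the \<open>e\<^sub>a\<close>, and contracting it with the Levi-Civita tensor produces the
  same determinant \<open>n!\<close> times, while the density cancels against \<open>\<gamma>\<close>. Hence
  \<open>\<langle>v, Z\<^sub>\<alpha>\<rangle> = sqrt (det G / (det g (p-1)!)) det (v, e\<^sub>1, \<dots>, e\<^sub>n, \<partial>\<^sub>\<alpha>)\<close>
  (lemma \<open>metric_inner_Z_lower\<close>). The right-hand side is multilinear in the last \<open>p - 1\<close>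
  slots, so \<open>Z\<close> can be evaluated on lists \<open>c\<close> of arbitrary vectors instead of coordinate vectors.

  Let \<open>c\<close> run through the lists of length \<open>p - 1\<close> over a \<open>G\<close>-orthonormal basis that consists of
  tangent and normal vectors. For a normal basis vector \<open>b\<close>, the number \<open>\<langle>b, Z c\<rangle>\<close> vanishes unless
  \<open>c\<close> is one of the \<open>(p-1)!\<close> enumerations of the other normal basis vectors, and then its square is
  \<open>1 / (p-1)!\<close> by Gram's determinant formula. Therefore every normal vector satisfies
  \<open>v = \<Sum>\<^sub>c \<langle>v, Z c\<rangle> Z c\<close> (lemma \<open>resolution_of_normals\<close>).

  Coefficients with respect to orthonormal bases of the space of multi-vectors are related by
  orthogonal matrices: \<open>N\<^sub>\<alpha> = \<Sum>\<^sub>c F\<^sub>\<alpha>\<^sub>c Z c\<close> with \<open>F\<close> orthogonal. So the resolution persists as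
  \<open>v = \<Sum>\<^sub>\<alpha> \<langle>v, N\<^sub>\<alpha>\<rangle> N\<^sub>\<alpha>\<close> (lemma \<open>combination_tight\<close>), for any orthonormal \<open>E\<close>. The eigenvector
  equations enter only through \<open>\<langle>N\<^sub>\<alpha>, N\<^sub>\<beta>\<rangle> = 0\<close> for \<open>\<alpha> \<noteq> \<beta>\<close> (lemma \<open>combination_orthogonal\<close>). Applied to
  \<open>v = N\<^sub>\<beta>\<close>, the resolution now reads \<open>N\<^sub>\<beta> = \<langle>N\<^sub>\<beta>, N\<^sub>\<beta>\<rangle> N\<^sub>\<beta>\<close>, so \<open>N\<^sub>\<beta>\<close> is zero or a unit vector; the
  non-zero ones are orthonormal and span the normal space, whose dimension is \<open>p\<close>
  (lemma \<open>orthonormal_basis_of_tight_family\<close>).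
\<close>

section \<open>Positions in a finite linear order\<close>

text \<open>The number that \<open>levi_civita_symbol\<close> uses to read a list as a map on indices. It also serves to
  number the rows of a matrix.\<close>

definition place :: "'i::{finite,linorder} \<Rightarrow> nat" where
  "place i = card {j. j < i}"

lemma place_bij: "bij_betw (place :: 'i::{finite,linorder} \<Rightarrow> nat) UNIV {..<CARD('i)}"
proof -
  have lt: "place a < place b" if "a < b" for a b :: 'i
    unfolding place_def by (rule psubset_card_mono) (use that in auto)
  have inj: "inj (place :: 'i \<Rightarrow> nat)"
    by (rule injI) (metis lt less_irrefl linorder_cases)
  moreover have "range (place :: 'i \<Rightarrow> nat) \<subseteq> {..<CARD('i)}"
    unfolding place_def by (auto intro!: psubset_card_mono)
  ultimately show ?thesis
    unfolding bij_betw_def by (metis card_image card_lessThan card_subset_eq finite_lessThan)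
qed

lemma place_less: "place (i :: 'i::{finite,linorder}) < CARD('i)"
  using place_bij[where 'i='i] by (auto simp: bij_betw_def)

lemma place_eq_iff [simp]: "place i = place j \<longleftrightarrow> i = j"
  using place_bij by (auto simp: bij_betw_def inj_on_def)

lemma ex_place:
  assumes "k < CARD('i)" obtains i :: "'i::{finite,linorder}" where "place i = k"
  using place_bij[where 'i='i] assms unfolding bij_betw_def by (metis imageE lessThan_iff)

lemma place_inv: "k < CARD('i) \<Longrightarrow> place (inv place k :: 'i::{finite,linorder}) = k"
  by (metis ex_place f_inv_into_f rangeI)

definition ordered_indices :: "'n::{finite,linorder} list" where
  "ordered_indices = map (inv place) [0..<CARD('n)]"

lemma length_ordered_indices [simp]: "length (ordered_indices :: 'n::{finite,linorder} list) = CARD('n)"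
  by (simp add: ordered_indices_def)

lemma ordered_indices_nth_place [simp]: "ordered_indices ! place a = a"
proof -
  have "inj (place :: 'a \<Rightarrow> nat)" using place_bij by (auto simp: bij_betw_def)
  then show ?thesis by (simp add: ordered_indices_def place_less)
qed

section \<open>Sums over lists of fixed length\<close>

lemma sum_lists_Suc:
  "(\<Sum>l | set l \<subseteq> B \<and> length l = Suc n. f l) =
   (\<Sum>b\<in>B. \<Sum>l | set l \<subseteq> B \<and> length l = n. f (b # l))"
proof -
  have "(\<Sum>b\<in>B. \<Sum>l | set l \<subseteq> B \<and> length l = n. f (b # l)) =
    (\<Sum>(b, l)\<in>B \<times> {l. set l \<subseteq> B \<and> length l = n}. f (b # l))"
    by (rule sum.cartesian_product)
  also have "\<dots> = (\<Sum>l | set l \<subseteq> B \<and> length l = Suc n. f l)"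
    by (rule sum.reindex_bij_witness[where j = "\<lambda>(b, l). b # l" and i = "\<lambda>l. (hd l, tl l)"])
      (auto simp: length_Suc_conv)
  finally show ?thesis by simp
qed

lemma sum_lists_Suc_UNIV:
  "(\<Sum>l | length l = Suc n. f l) = (\<Sum>b\<in>UNIV. \<Sum>l | length l = n. f (b # l))"
  using sum_lists_Suc[where B = UNIV and n = n and f = f] by simp

text \<open>This is what makes tensor products behave: a contraction over multi-indices of products of
  matrix entries is computed one slot at a time.\<close>

lemma prod_sum_lists:
  fixes f :: "nat \<Rightarrow> 'b \<Rightarrow> 'c::comm_semiring_1"
  shows "(\<Prod>k<n. \<Sum>b\<in>B. f k b) = (\<Sum>l | set l \<subseteq> B \<and> length l = n. \<Prod>k<n. f k (l ! k))"
proof (induction n arbitrary: f)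
  case 0
  have "{l. set l \<subseteq> B \<and> length l = 0} = {[]}" by auto
  then show ?case by simp
next
  case (Suc n)
  have "(\<Prod>k<Suc n. \<Sum>b\<in>B. f k b) = (\<Sum>b\<in>B. f 0 b) * (\<Prod>k<n. \<Sum>b\<in>B. f (Suc k) b)"
    by (rule prod.lessThan_Suc_shift)
  then show ?case
    by (simp add: Suc sum_lists_Suc prod.lessThan_Suc_shift sum_distrib_left sum_distrib_right
        del: prod.lessThan_Suc)
      (rule sum.swap)
qed

lemma prod_sum_lists_UNIV:
  fixes f :: "nat \<Rightarrow> 'b \<Rightarrow> 'c::comm_semiring_1"
  shows "(\<Prod>k<n. \<Sum>b\<in>UNIV. f k b) = (\<Sum>l | length l = n. \<Prod>k<n. f k (l ! k))"
  using prod_sum_lists[of f UNIV n] by simp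

lemma prod_kronecker_lists:
  assumes "length \<alpha> = n" "length \<beta> = n"
  shows "(\<Prod>k<n. if \<alpha> ! k = \<beta> ! k then 1 else 0) = (if \<alpha> = \<beta> then 1 else (0 :: real))"
proof (cases "\<alpha> = \<beta>")
  case False
  then obtain k where "k < n" "\<alpha> ! k \<noteq> \<beta> ! k" using assms by (metis nth_equalityI)
  then have "(\<Prod>k<n. if \<alpha> ! k = \<beta> ! k then 1 else (0 :: real)) = 0"
    by (intro prod_zero) auto
  then show ?thesis using False by simp
qed simp

section \<open>Determinants\<close>

text \<open>Outside the block the rows are diagonal, so a permutation contributes to the Leibniz sum only
  if it fixes every index outside \<open>range f\<close>; such permutations are the conjugates under \<open>f\<close> of the
  permutations of \<open>'n\<close>, with the same sign.\<close>

lemma det_block: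
  fixes A :: "real^'m::finite^'m" and f :: "'n::finite \<Rightarrow> 'm"
  assumes inj: "inj f"
    and off: "\<And>i j. i \<notin> range f \<Longrightarrow> i \<noteq> j \<Longrightarrow> A $ i $ j = 0"
  shows "det A = det (\<chi> a b. A $ f a $ f b) * (\<Prod>i\<in>-range f. A $ i $ i)"
proof -
  let ?F = "map_permutation UNIV f" and ?G = "map_permutation (range f) (inv f)"
  have bf: "bij_betw f UNIV (range f)" and bg: "bij_betw (inv f) (range f) UNIV"
    using inj by (auto simp: inj_imp_bij_betw_inv inj_on_imp_bij_betw)
  have z: "(\<Prod>i\<in>UNIV. A $ i $ p i) = 0" if "p permutes UNIV" "\<not> p permutes range f" for p
  proof -
    have "\<exists>i. i \<notin> range f \<and> p i \<noteq> i"
    proof (rule ccontr)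
      assume "\<not> ?thesis"
      then have "p permutes range f" by (intro permutes_superset[OF that(1)]) blast
      then show False using that(2) by blast
    qed
    then obtain i where i: "i \<notin> range f" "p i \<noteq> i" by blast
    then have "A $ i $ p i = 0" by (intro off) auto
    then show ?thesis by (intro prod_zero) auto
  qed
  have "det A = (\<Sum>p | p permutes range f. of_int (sign p) * (\<Prod>i\<in>UNIV. A $ i $ p i))"
    unfolding det_def by (rule sum.mono_neutral_right) (auto simp: z intro: permutes_subset)
  also have "\<dots> = (\<Sum>p | p permutes (UNIV::'n set). of_int (sign p) *
      ((\<Prod>a\<in>UNIV. A $ f a $ f (p a)) * (\<Prod>i\<in>-range f. A $ i $ i)))"
  proof (rule sum.reindex_bij_witness[where i = ?F and j = ?G])
    fix p assume "p \<in> {p. p permutes range f}"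
    then have p: "p permutes range f" by simp
    show FG: "?F (?G p) = p"
      by (rule map_permutation_compose_inv[OF bg p]) (simp add: f_inv_into_f)
    show Gp: "?G p \<in> {p. p permutes UNIV}"
      using map_permutation_permutes[OF bg p] by simp
    have sg: "sign (?G p) = sign p"
      by (rule sign_map_permutation) (use p bg in \<open>auto simp: bij_betw_def\<close>)
    have app: "f (?G p a) = p (f a)" for a
      by (metis FG inj map_permutation_apply UNIV_I)
    have "(\<Prod>i\<in>UNIV. A $ i $ p i) = (\<Prod>i\<in>range f. A $ i $ p i) * (\<Prod>i\<in>-range f. A $ i $ p i)"
      by (subst prod.union_disjoint[symmetric]) auto
    also have "(\<Prod>i\<in>range f. A $ i $ p i) = (\<Prod>a\<in>UNIV. A $ f a $ f (?G p a))"
      by (simp add: prod.reindex[OF inj] app)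
    also have "(\<Prod>i\<in>-range f. A $ i $ p i) = (\<Prod>i\<in>-range f. A $ i $ i)"
      by (rule prod.cong) (use p in \<open>auto simp: permutes_def\<close>)
    finally show "of_int (sign (?G p)) * ((\<Prod>a\<in>UNIV. A $ f a $ f (?G p a)) * (\<Prod>i\<in>-range f. A $ i $ i))
      = of_int (sign p) * (\<Prod>i\<in>UNIV. A $ i $ p i)" by (simp add: sg)
  next
    fix p :: "'n \<Rightarrow> 'n" assume "p \<in> {p. p permutes UNIV}"
    then have p: "p permutes UNIV" by simp
    show "?G (?F p) = p"
      by (rule map_permutation_compose_inv[OF bf p]) (simp add: inj)
    show "?F p \<in> {p. p permutes range f}"
      using map_permutation_permutes[OF bf p] by simp
  qed
  also have "\<dots> = det (\<chi> a b. A $ f a $ f b) * (\<Prod>i\<in>-range f. A $ i $ i)"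
    unfolding det_def by (simp add: sum_distrib_right mult.assoc)
  finally show ?thesis .
qed

lemma det_zero_row_in_span:
  fixes A :: "real^'m^'m"
  assumes "A $ i \<in> span {A $ j |j. j \<noteq> i}"
  shows "det A = 0"
proof -
  have "- row i A \<in> span {row j A |j. j \<noteq> i}"
    using assms by (simp add: row_def span_neg)
  then have "det A = det (\<chi> k. if k = i then row i A + (- row i A) else row k A)"
    by (subst det_row_span) (auto simp: span_vec_eq)
  also have "\<dots> = 0" unfolding add.right_inverse by (rule det_row_0)
  finally show ?thesis .
qed

text \<open>Along the segment from the identity to \<open>A\<close> all matrices are positive definite, hence
  non-singular, so the determinant cannot change sign.\<close>

lemma det_pos_if_pos_def:
  fixes A :: "real^'k^'k"
  assumes pos: "\<And>v. v \<noteq> 0 \<Longrightarrow> v \<bullet> (A *v v) > 0"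
  shows "det A > 0"
proof (rule ccontr)
  assume neg: "\<not> det A > 0"
  \<comment> \<open>The segment from the identity to \<open>A\<close>.\<close>
  define B where "B t = (1 - t) *\<^sub>R mat 1 + t *\<^sub>R A" for t
  have cont: "continuous_on {0..1} (\<lambda>t. det (B t))"
    unfolding det_def B_def by (auto intro!: continuous_intros)
  have "\<exists>t. 0 \<le> t \<and> t \<le> 1 \<and> det (B t) = 0"
    by (rule IVT2') (use neg cont in \<open>auto simp: B_def\<close>)
  then obtain t where t: "0 \<le> t" "t \<le> 1" "det (B t) = 0" by blast
  then obtain v where v: "v \<noteq> 0" "B t *v v = 0"
    using invertible_det_nz[of "B t"] matrix_left_invertible_ker[of "B t"]
    by (auto simp: invertible_left_inverse)
  have "v \<bullet> (B t *v v) = (1 - t) * (v \<bullet> v) + t * (v \<bullet> (A *v v))"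
    by (simp add: B_def matrix_vector_mult_add_rdistrib scaleR_matrix_vector_assoc[symmetric] inner_add_right)
  moreover have "\<dots> > 0"
  proof (cases "t = 1")
    case False
    then show ?thesis using t pos[OF v(1)] v(1)
      by (intro add_pos_nonneg mult_pos_pos mult_nonneg_nonneg) (auto simp: less_imp_le)
  qed (use pos[OF v(1)] in auto)
  ultimately show False using v(2) by simp
qed

definition vdet :: "'m::{finite,linorder} rvec list \<Rightarrow> real" where
  "vdet vs = det (\<chi> i. vs ! place i)"

lemma vdet_slot:
  fixes w :: "'m::{finite,linorder} rvec"
  assumes "length us + Suc (length zs) = CARD('m)"
  shows "vdet (us @ w # zs) = (\<Sum>i\<in>UNIV. w $ i * vdet (us @ axis i 1 # zs))"
proof -
  obtain k :: 'm where k: "place k = length us"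
    by (rule ex_place[of "length us"]) (use assms in auto)
  define c where "c i = (us @ 0 # zs) ! place i" for i :: 'm
  have slot: "(us @ v # zs) ! place i = (if i = k then v else c i)" for v i
    using k place_eq_iff[of i k] by (auto simp: c_def nth_append nth_Cons split: nat.splits)
  have "vdet (us @ w # zs) = det (\<chi> i. if i = k then \<Sum>j\<in>UNIV. w $ j *s axis j 1 else c i)"
    unfolding vdet_def slot basis_expansion ..
  then show ?thesis
    by (simp add: vdet_def slot det_linear_row_sum det_row_mul)
qed

text \<open>Multilinearity in a block of consecutive slots, the form in which the Levi-Civita symbol is
  contracted with a product of components.\<close>

lemma vdet_expand_block:
  fixes ws :: "'m::{finite,linorder} rvec list"
  assumes "length us + length ws + length zs = CARD('m)"
  shows "vdet (us @ ws @ zs) = (\<Sum>ks | length ks = length ws.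
    vdet (us @ map (\<lambda>i. axis i 1) ks @ zs) * (\<Prod>k<length ws. ws ! k $ (ks ! k)))"
  using assms
proof (induction ws arbitrary: us)
  case (Cons w ws)
  have "vdet (us @ (w # ws) @ zs) = (\<Sum>i\<in>UNIV. w $ i * vdet ((us @ [axis i 1]) @ ws @ zs))"
    using vdet_slot[of us "ws @ zs" w] Cons.prems by simp
  also have "\<dots> = (\<Sum>i\<in>UNIV. w $ i * (\<Sum>ks | length ks = length ws.
    vdet ((us @ [axis i 1]) @ map (\<lambda>i. axis i 1) ks @ zs) * (\<Prod>k<length ws. ws ! k $ (ks ! k))))"
    by (intro sum.cong refl, subst Cons.IH) (use Cons.prems in auto)
  also have "\<dots> = (\<Sum>ks | length ks = length (w # ws).
    vdet (us @ map (\<lambda>i. axis i 1) ks @ zs) * (\<Prod>k<length (w # ws). (w # ws) ! k $ (ks ! k)))"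
    by (simp add: sum_lists_Suc_UNIV prod.lessThan_Suc_shift sum_distrib_left mult_ac del: prod.lessThan_Suc)
  finally show ?case .
qed simp

lemma vdet_zero_if_in_span:
  fixes vs :: "'m::{finite,linorder} rvec list"
  assumes "length vs = CARD('m)" "k < CARD('m)"
    and "vs ! k \<in> span {vs ! j |j. j < CARD('m) \<and> j \<noteq> k}"
  shows "vdet vs = 0"
proof -
  obtain i :: 'm where i: "place i = k" using ex_place[OF assms(2)] .
  have "{vs ! j |j. j < CARD('m) \<and> j \<noteq> k} \<subseteq> {(\<chi> i. vs ! place i) $ j |j. j \<noteq> i}"
    using i ex_place[where 'i = 'm] by fastforce
  then show ?thesis
    unfolding vdet_def using assms(3) i
    by (intro det_zero_row_in_span[of _ i]) (auto dest: span_mono)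
qed

lemma vdet_not_distinct:
  fixes vs :: "'m::{finite,linorder} rvec list"
  assumes "length vs = CARD('m)" "\<not> distinct vs"
  shows "vdet vs = 0"
proof -
  obtain j k where "j < CARD('m)" "k < CARD('m)" "j \<noteq> k" "vs ! k = vs ! j"
    using assms by (auto simp: distinct_conv_nth)
  then show ?thesis
    by (intro vdet_zero_if_in_span[of _ k] assms) (auto intro: span_base)
qed

lemma permutes_nth_place:
  fixes l :: "'i::{finite,linorder} list"
  assumes "distinct l" "length l = CARD('i)"
  shows "(\<lambda>i. l ! place i) permutes UNIV"
proof -
  have "inj (\<lambda>i :: 'i. l ! place i)"
    using assms by (auto intro!: injI simp: nth_eq_iff_index_eq place_less)
  then have "bij (\<lambda>i :: 'i. l ! place i)"
    using finite_UNIV_inj_surj[of "\<lambda>i :: 'i. l ! place i"] by (simp add: bij_def)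
  then show ?thesis by (intro bij_imp_permutes) auto
qed

section \<open>The Levi-Civita symbol\<close>

text \<open>For a list of all indices the rows are those of a permuted identity matrix; otherwise two rows
  agree.\<close>

lemma levi_civita_symbol_eq_vdet:
  fixes l :: "'m::{finite,linorder} list"
  assumes "length l = CARD('m)"
  shows "levi_civita_symbol l = vdet (map (\<lambda>i. axis i 1) l)"
proof (cases "distinct l")
  case True
  then have set: "set l = UNIV"
    using assms by (metis card_subset_eq distinct_card finite subset_UNIV)
  let ?p = "\<lambda>i. l ! place i"
  have p: "?p permutes UNIV" using True assms by (rule permutes_nth_place)
  have row: "map (\<lambda>i. axis i 1) l ! place i = (mat 1 :: 'm rmat) $ ?p i" for i :: 'm
    using assms by (auto simp: vec_eq_iff mat_def axis_def place_less)
  have "vdet (map (\<lambda>i. axis i 1) l) = of_int (sign ?p)"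
    using det_permute_rows[OF p, of "mat 1 :: 'm rmat"] by (simp add: vdet_def row)
  then show ?thesis
    using True set by (simp add: levi_civita_symbol_def place_def)
next
  case False
  then have "\<not> distinct (map (\<lambda>i. axis i 1 :: 'm rvec) l)" by (simp add: distinct_map)
  then show ?thesis
    using False assms by (simp add: levi_civita_symbol_def vdet_not_distinct)
qed

text \<open>The places \<open>s, \<dots>, s + n - 1\<close> of an \<open>m\<close>-element index type are a copy of an \<open>n\<close>-element one.
  This is how the tangent frame, which is indexed by \<open>'n\<close>, sits inside a list of \<open>m\<close> rows.\<close>

lemma block_embedding:
  assumes "s + CARD('n::{finite,linorder}) \<le> CARD('m::{finite,linorder})"
  obtains f :: "'n::{finite,linorder} \<Rightarrow> 'm::{finite,linorder}" where "inj f" "\<And>a. place (f a) = s + place a"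
    "\<And>i. i \<notin> range f \<Longrightarrow> place i < s \<or> s + CARD('n) \<le> place i"
proof -
  define f :: "'n \<Rightarrow> 'm" where "f a = inv place (s + place a)" for a
  have pf: "place (f a) = s + place a" for a
    unfolding f_def by (rule place_inv) (use place_less[of a] assms in simp)
  have f: "inj f" by (rule injI) (metis pf add_left_imp_eq place_eq_iff)
  have outside: "place i < s \<or> s + CARD('n) \<le> place i" if "i \<notin> range f" for i
  proof (rule ccontr)
    assume "\<not> ?thesis"
    then have i: "s \<le> place i" "place i - s < CARD('n)" by auto
    obtain a :: 'n where "place a = place i - s"
      using i(2) by (rule ex_place)
    then have "place i = place (f a)" using i by (simp add: pf)
    then show False using that by auto
  qed
  show thesis using that[OF f pf outside] .
qed

lemma vdet_permute_block:
  fixes e :: "'n::{finite,linorder} \<Rightarrow> 'm::{finite,linorder} rvec"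
  assumes l: "distinct l" "set l = UNIV"
    and len: "length us + CARD('n) + length zs = CARD('m)"
  shows "vdet (us @ map e l @ zs) = levi_civita_symbol l * vdet (us @ map e ordered_indices @ zs)"
proof -
  have ll: "length l = CARD('n)" using l by (metis distinct_card)
  obtain f :: "'n \<Rightarrow> 'm" where f: "inj f" and pf: "\<And>a. place (f a) = length us + place a"
    and outside: "\<And>i. i \<notin> range f \<Longrightarrow> place i < length us \<or> length us + CARD('n) \<le> place i"
    using block_embedding[where s = "length us" and 'n = 'n and 'm = 'm] len by auto
  let ?p = "\<lambda>a. l ! place a"
  have p: "?p permutes UNIV" using l(1) ll by (rule permutes_nth_place)
  let ?P = "map_permutation UNIV f ?p"
  have P: "?P permutes range f"
    using p f by (intro map_permutation_permutes) (auto simp: inj_on_imp_bij_betw)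
  have "(us @ map e l @ zs) ! place i = (us @ map e ordered_indices @ zs) ! place (?P i)" for i
  proof (cases "i \<in> range f")
    case True
    then obtain a where "i = f a" by auto
    then show ?thesis
      using f by (simp add: map_permutation_apply pf nth_append ll place_less)
  next
    case False
    then have "?P i = i" using P by (auto simp: permutes_def)
    then show ?thesis using outside[OF False] by (auto simp: nth_append ll)
  qed
  then have "vdet (us @ map e l @ zs) = det (\<chi> i. (\<chi> j. (us @ map e ordered_indices @ zs) ! place j) $ ?P i)"
    by (simp add: vdet_def)
  also have "\<dots> = of_int (sign ?P) * vdet (us @ map e ordered_indices @ zs)"
    unfolding vdet_def by (rule det_permute_rows) (use P in \<open>auto intro: permutes_subset\<close>)
  also have "sign ?P = sign ?p"
    using p f by (intro sign_map_permutation) auto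
  finally show ?thesis
    using l by (simp add: levi_civita_symbol_def place_def)
qed

text \<open>The left-hand side counts permutations, as signs square to one. This is the \<open>n!\<close> in the
  normalisation of \<open>Z_lower\<close>.\<close>

lemma sum_levi_civita_symbol_squared:
  "(\<Sum>l :: 'n::{finite,linorder} list | length l = CARD('n). (levi_civita_symbol l)\<^sup>2) = fact CARD('n)"
proof -
  have "(\<Sum>l :: 'n list | length l = CARD('n). (levi_civita_symbol l)\<^sup>2) =
    (\<Sum>l :: 'n list | length l = CARD('n) \<and> distinct l \<and> set l \<subseteq> UNIV. 1)"
  proof (rule sum.mono_neutral_cong_right)
    show "finite {l :: 'n list. length l = CARD('n)}"
      using finite_lists_length_eq[of "UNIV :: 'n set" "CARD('n)"] by simp
    show "(levi_civita_symbol l)\<^sup>2 = 1"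
      if "l \<in> {l :: 'n list. length l = CARD('n) \<and> distinct l \<and> set l \<subseteq> UNIV}" for l
    proof -
      have "set l = UNIV"
        using that by (metis (mono_tags) card_subset_eq distinct_card finite mem_Collect_eq)
      then show ?thesis using that by (simp add: levi_civita_symbol_def sign_def)
    qed
  qed (auto simp: levi_civita_symbol_def)
  also have "\<dots> = fact CARD('n)"
    using card_lists_distinct_length_eq[of "UNIV :: 'n set" "CARD('n)"] by (simp add: fact_prod)
  finally show ?thesis .
qed

section \<open>The vectors \<open>Z\<close> as determinants\<close>

lemma metric_inner_eq: "metric_inner G v w = v \<bullet> (G *v w)"
  by (simp add: metric_inner_def matrix_vector_mult_def inner_vec_def sum_distrib_left mult_ac)

lemma metric_inner_add_left: "metric_inner G (v + w) z = metric_inner G v z + metric_inner G w z"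
  and metric_inner_add_right: "metric_inner G z (v + w) = metric_inner G z v + metric_inner G z w"
  and metric_inner_diff_left: "metric_inner G (v - w) z = metric_inner G v z - metric_inner G w z"
  and metric_inner_scaleR_left: "metric_inner G (c *\<^sub>R v) z = c * metric_inner G v z"
  and metric_inner_scaleR_right: "metric_inner G z (c *\<^sub>R v) = c * metric_inner G z v"
  and metric_inner_zero_left: "metric_inner G 0 z = 0"
  and metric_inner_zero_right: "metric_inner G z 0 = 0"
  by (simp_all add: metric_inner_eq inner_add_left inner_diff_left matrix_vector_right_distrib
      inner_add_right matrix_vector_mult_scaleR)

lemma metric_inner_sum_left: "metric_inner G (\<Sum>a\<in>A. f a) z = (\<Sum>a\<in>A. metric_inner G (f a) z)"
  by (induction A rule: infinite_finite_induct)
    (simp_all add: metric_inner_add_left metric_inner_zero_left)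

lemma metric_inner_sum_right: "metric_inner G z (\<Sum>a\<in>A. f a) = (\<Sum>a\<in>A. metric_inner G z (f a))"
  by (induction A rule: infinite_finite_induct)
    (simp_all add: metric_inner_add_right metric_inner_zero_right)

lemmas metric_inner_bilinear = metric_inner_add_left metric_inner_add_right metric_inner_diff_left
  metric_inner_scaleR_left metric_inner_scaleR_right metric_inner_zero_left metric_inner_zero_right
  metric_inner_sum_left metric_inner_sum_right

text \<open>Gram's formula \<open>A G A\<^sup>T\<close> for the rows \<open>A\<close>.\<close>

lemma vdet_squared_eq_gram:
  fixes G :: "'m::{finite,linorder} rmat"
  shows "(vdet vs)\<^sup>2 * det G = 
    det ((\<chi> i j. metric_inner G (vs ! place i) (vs ! place j)) :: 'm rmat)"
proof -
  let ?A = "\<chi> i. vs ! place i :: 'm rmat"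
  have "(\<chi> i j. metric_inner G (vs ! place i) (vs ! place j)) = ?A ** G ** transpose ?A"
    by (auto simp: vec_eq_iff metric_inner_def matrix_matrix_mult_def transpose_def
        sum_distrib_left sum_distrib_right mult_ac intro!: sum.swap)
  then show ?thesis
    by (simp add: vdet_def det_mul power2_eq_square)
qed

lemma sum_levi_civita_frames:
  fixes e :: "'n::{finite,linorder} \<Rightarrow> 'm::{finite,linorder} rvec"
  assumes len: "length us + CARD('n) + length zs = CARD('m)"
  shows "(\<Sum>l | length l = CARD('n). levi_civita_symbol l * vdet (us @ map e l @ zs)) =
    fact CARD('n) * vdet (us @ map e ordered_indices @ zs)"
proof -
  have "levi_civita_symbol l * vdet (us @ map e l @ zs) =
    (levi_civita_symbol l)\<^sup>2 * vdet (us @ map e ordered_indices @ zs)" for l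
  proof (cases "distinct l \<and> set l = UNIV")
    case True
    then show ?thesis
      using vdet_permute_block[of l us zs e] len by (simp add: power2_eq_square)
  next
    case False
    then show ?thesis by (auto simp: levi_civita_symbol_def)
  qed
  then show ?thesis
    by (simp add: sum_distrib_right[symmetric] sum_levi_civita_symbol_squared)
qed

lemma multibracket_coordinates:
  fixes x :: "'n::{finite,linorder} rvec \<Rightarrow> 'm::{finite,linorder} rvec"
  assumes "length ks = CARD('n)"
  shows "multibracket r (map (\<lambda>k u. x u $ k) ks) u = 1 / r u * (\<Sum>l | length l = CARD('n).
    levi_civita_symbol l * (\<Prod>k<CARD('n). map (frame x u) l ! k $ (ks ! k)))"
  unfolding multibracket_def
  by (intro arg_cong2[of _ _ _ _ "(*)"] refl sum.cong prod.cong) (use assms in \<open>auto simp: frame_def\<close>)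

lemma matrix_inv_inverse:
  fixes A :: "real^'k^'k"
  assumes "invertible A"
  shows "A ** matrix_inv A = mat 1" "matrix_inv A ** A = mat 1"
  using someI_ex[of "\<lambda>B. A ** B = mat 1 \<and> B ** A = mat 1"] assms
  by (auto simp: invertible_def matrix_inv_def)

lemma multi_indices_finite: "finite (multi_indices p :: 'm::finite list set)"
  using finite_lists_length_eq[of "UNIV :: 'm set" "p - 1"] by (simp add: multi_indices_def)

lemma multi_metric_inverse:
  fixes G :: "'m::finite rmat"
  assumes "invertible G" and "\<alpha> \<in> multi_indices p" "\<beta> \<in> multi_indices p"
  shows "(\<Sum>\<sigma>\<in>multi_indices p. multi_metric G \<alpha> \<sigma> * multi_metric (matrix_inv G) \<sigma> \<beta>) =
    (if \<alpha> = \<beta> then 1 else 0)"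
proof -
  have "(\<Sum>\<sigma>\<in>multi_indices p. multi_metric G \<alpha> \<sigma> * multi_metric (matrix_inv G) \<sigma> \<beta>) =
    (\<Sum>\<sigma> | length \<sigma> = p - 1. \<Prod>k<p - 1. G $ (\<alpha> ! k) $ (\<sigma> ! k) * matrix_inv G $ (\<sigma> ! k) $ (\<beta> ! k))"
    unfolding multi_indices_def
    by (intro sum.cong refl) (use assms(2) in \<open>auto simp: multi_metric_def multi_indices_def prod.distrib\<close>)
  also have "\<dots> = (\<Prod>k<p - 1. \<Sum>i\<in>UNIV. G $ (\<alpha> ! k) $ i * matrix_inv G $ i $ (\<beta> ! k))"
    by (rule prod_sum_lists_UNIV[symmetric])
  also have "\<dots> = (\<Prod>k<p - 1. (G ** matrix_inv G) $ (\<alpha> ! k) $ (\<beta> ! k))"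
    by (simp add: matrix_matrix_mult_def)
  also have "\<dots> = (\<Prod>k<p - 1. if \<alpha> ! k = \<beta> ! k then 1 else 0)"
    by (simp add: matrix_inv_inverse(1)[OF assms(1)] mat_def)
  also have "\<dots> = (if \<alpha> = \<beta> then 1 else 0)"
    by (rule prod_kronecker_lists) (use assms in \<open>auto simp: multi_indices_def\<close>)
  finally show ?thesis .
qed

text \<open>Lowering the index of \<open>Z_lower\<close> cancels the inverse metric. Expanding the bracket into the
  tangent frame leaves, for each ordering \<open>l\<close> of the frame, the determinant with rows \<open>v\<close>, the frame
  in the order \<open>l\<close>, and coordinate vectors; with its Levi-Civita sign each of them equals the one in
  increasing order. The factor \<open>1 / r u\<close> of the bracket cancels the one in \<open>gamma_factor\<close>.\<close>

lemma metric_inner_Z_lower: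
  fixes x :: "'n::{finite,linorder} rvec \<Rightarrow> 'm::{finite,linorder} rvec"
  assumes inv: "invertible G" and r: "r u \<noteq> 0"
    and dim: "CARD('m) = CARD('n) + p" "p \<ge> 1" and \<alpha>: "length \<alpha> = p - 1"
  shows "metric_inner G v (Z_lower p G x r u \<alpha>) =
    sqrt (det G) / (sqrt (det (induced_metric G x u)) * sqrt (fact (p - 1))) *
    vdet (v # map (frame x u) ordered_indices @ map (\<lambda>i. axis i 1) \<alpha>)"
proof -
  let ?e = "frame x u" and ?ax = "map (\<lambda>i. axis i 1 :: 'm rvec)"
  define C where "C = 1 / (gamma_factor G x r u * fact CARD('n) * sqrt (fact (p - 1)))"
  define S where "S = (\<chi> j. \<Sum>ks | length ks = CARD('n). levi_civita_tensor G (j # ks @ \<alpha>) *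
    multibracket r (map (\<lambda>k u. x u $ k) ks) u)"
  have Z: "Z_lower p G x r u \<alpha> = C *\<^sub>R (matrix_inv G *v S)"
    by (simp add: vec_eq_iff Z_lower_def C_def S_def matrix_vector_mult_def sum_distrib_left mult_ac)
  have contraction: "(\<Sum>j\<in>UNIV. v $ j * (\<Sum>ks | length ks = CARD('n). levi_civita_symbol (j # ks @ \<alpha>) *
      (\<Prod>k<CARD('n). map ?e l ! k $ (ks ! k)))) = vdet (v # map ?e l @ ?ax \<alpha>)"
    if "length l = CARD('n)" for l
  proof -
    have "vdet ([] @ v # map ?e l @ ?ax \<alpha>) =
      (\<Sum>j\<in>UNIV. v $ j * vdet ([axis j 1] @ map ?e l @ ?ax \<alpha>))"
      by (subst vdet_slot) (use that dim \<alpha> in auto)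
    also have "\<dots> = (\<Sum>j\<in>UNIV. v $ j * (\<Sum>ks | length ks = CARD('n).
      levi_civita_symbol (j # ks @ \<alpha>) * (\<Prod>k<CARD('n). map ?e l ! k $ (ks ! k))))"
      by (intro sum.cong refl, subst vdet_expand_block)
        (use that dim \<alpha> in \<open>auto simp: levi_civita_symbol_eq_vdet intro!: sum.cong\<close>)
    finally show ?thesis by simp
  qed
  have "v \<bullet> S = sqrt (det G) / r u * (\<Sum>l | length l = CARD('n). levi_civita_symbol l *
    (\<Sum>j\<in>UNIV. v $ j * (\<Sum>ks | length ks = CARD('n). levi_civita_symbol (j # ks @ \<alpha>) *
      (\<Prod>k<CARD('n). map ?e l ! k $ (ks ! k)))))" (is "_ = ?R")
  proof -
    have "?R = (\<Sum>l | length l = CARD('n). \<Sum>j\<in>UNIV. \<Sum>ks | length ks = CARD('n).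
      v $ j * (sqrt (det G) * levi_civita_symbol (j # ks @ \<alpha>) * (1 / r u * (levi_civita_symbol l *
      (\<Prod>k<CARD('n). map ?e l ! k $ (ks ! k))))))"
      by (simp add: sum_distrib_left mult_ac)
    also have "\<dots> = (\<Sum>j\<in>UNIV. \<Sum>ks | length ks = CARD('n). \<Sum>l | length l = CARD('n).
      v $ j * (sqrt (det G) * levi_civita_symbol (j # ks @ \<alpha>) * (1 / r u * (levi_civita_symbol l *
      (\<Prod>k<CARD('n). map ?e l ! k $ (ks ! k))))))"
      by (subst sum.swap) (intro sum.cong refl sum.swap)
    also have "\<dots> = v \<bullet> S"
      by (simp add: inner_vec_def S_def levi_civita_tensor_def multibracket_coordinates
          sum_distrib_left)
    finally show ?thesis by simp
  qed
  also have "\<dots> = sqrt (det G) / r u * (\<Sum>l | length l = CARD('n). levi_civita_symbol l *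
    vdet (v # map ?e l @ ?ax \<alpha>))"
    by (intro arg_cong2[of _ _ _ _ "(*)"] refl sum.cong contraction) simp
  also have "\<dots> = sqrt (det G) / r u * (fact CARD('n) * vdet (v # map ?e ordered_indices @ ?ax \<alpha>))"
    using sum_levi_civita_frames[of "[v]" "?ax \<alpha>" ?e] dim \<alpha> by simp
  finally have "C * (v \<bullet> S) =
    C * (sqrt (det G) / r u * (fact CARD('n) * vdet (v # map ?e ordered_indices @ ?ax \<alpha>)))"
    by simp
  moreover have "metric_inner G v (Z_lower p G x r u \<alpha>) = C * (v \<bullet> S)"
    using matrix_inv_inverse(1)[OF inv]
    by (simp add: Z metric_inner_eq matrix_vector_mult_scaleR matrix_vector_mul_assoc)
  ultimately show ?thesis
    using r by (simp add: C_def gamma_factor_def field_simps)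
qed

section \<open>Orthonormal bases for a positive definite form\<close>

locale pos_def_metric =
  fixes G :: "'m::{finite,linorder} rmat"
  assumes symmetric: "transpose G = G" and positive: "v \<noteq> 0 \<Longrightarrow> v \<bullet> (G *v v) > 0"
begin

abbreviation ip :: "'m rvec \<Rightarrow> 'm rvec \<Rightarrow> real" where "ip \<equiv> metric_inner G"

definition orthonormal :: "'m rvec set \<Rightarrow> bool" where
  "orthonormal B \<longleftrightarrow> (\<forall>x\<in>B. \<forall>y\<in>B. ip x y = (if x = y then 1 else 0))"

lemma ip_commute: "ip v w = ip w v"
proof -
  have G: "G $ i $ j = G $ j $ i" for i j
    using arg_cong[OF symmetric, of "\<lambda>A. A $ i $ j"] by (simp add: transpose_def)
  have "ip v w = (\<Sum>j\<in>UNIV. \<Sum>i\<in>UNIV. G $ i $ j * v $ i * w $ j)"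
    unfolding metric_inner_def by (rule sum.swap)
  also have "\<dots> = ip w v"
    unfolding metric_inner_def by (intro sum.cong refl) (subst G, simp)
  finally show ?thesis .
qed

lemma ip_pos: "v \<noteq> 0 \<Longrightarrow> ip v v > 0"
  by (simp add: metric_inner_eq positive)

lemma det_metric_pos: "det G > 0"
  by (intro det_pos_if_pos_def positive)

lemma invertible_metric: "invertible G"
  using det_metric_pos by (simp add: invertible_det_nz)

lemma ip_orthonormal_sum:
  assumes "orthonormal B" "finite S" "S \<subseteq> B" "b \<in> S"
  shows "ip (\<Sum>c\<in>S. f c *\<^sub>R c) b = f b"
proof -
  have "ip (\<Sum>c\<in>S. f c *\<^sub>R c) b = (\<Sum>c\<in>S. if c = b then f b else 0)"
    unfolding metric_inner_bilinear
  proof (intro sum.cong refl)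
    fix c assume "c \<in> S"
    then have "ip c b = (if c = b then 1 else 0)"
      using assms unfolding orthonormal_def by blast
    then show "f c * ip c b = (if c = b then f b else 0)" by simp
  qed
  then show ?thesis using assms by simp
qed

lemma orthonormal_independent:
  assumes "orthonormal B"
  shows "independent B"
proof
  assume "dependent B"
  then obtain S f b where S: "finite S" "S \<subseteq> B" "b \<in> S" "f b \<noteq> 0" "(\<Sum>c\<in>S. f c *\<^sub>R c) = 0"
    unfolding dependent_explicit by blast
  then show False
    using ip_orthonormal_sum[OF assms S(1-3), of f] by (simp add: metric_inner_zero_left)
qed

lemma orthonormal_expansion:
  assumes B: "orthonormal B" and x: "x \<in> span B"
  shows "x = (\<Sum>b\<in>B. ip x b *\<^sub>R b)"
proof -
  have fin: "finite B" using orthonormal_independent[OF B] by (rule independent_imp_finite)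
  then obtain f where f: "x = (\<Sum>c\<in>B. f c *\<^sub>R c)" using x by (auto simp: span_finite)
  have "ip x b = f b" if "b \<in> B" for b
    using ip_orthonormal_sum[OF B fin order_refl that] by (simp add: f)
  then show ?thesis using f by simp
qed

text \<open>A largest orthonormal superset inside \<open>V\<close> exists because dimensions bound cardinalities, and it
  spans \<open>V\<close>: otherwise a missing vector, made orthogonal to the set and normalised, would enlarge it.\<close>

lemma orthonormal_extend:
  assumes "orthonormal B" "B \<subseteq> V" "subspace V"
  obtains C where "B \<subseteq> C" "orthonormal C" "span C = V"
proof -
  let ?P = "\<lambda>C. B \<subseteq> C \<and> C \<subseteq> V \<and> orthonormal C"
  have bound: "\<forall>C. ?P C \<longrightarrow> card C < Suc CARD('m)"
    using independent_bound[OF orthonormal_independent] by (auto simp: less_Suc_eq_le)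
  have "\<exists>C. ?P C \<and> (\<forall>D. ?P D \<longrightarrow> card D \<le> card C)"
    using ex_has_greatest_nat[of ?P B card "Suc CARD('m)", OF _ bound] assms(1,2) by simp
  then obtain C where C: "?P C" and max: "\<And>D. ?P D \<Longrightarrow> card D \<le> card C" by blast
  have fin: "finite C"
    using C by (intro independent_imp_finite orthonormal_independent) blast
  have "V \<subseteq> span C"
  proof (rule ccontr)
    assume "\<not> V \<subseteq> span C"
    then obtain x where x: "x \<in> V" "x \<notin> span C" by blast
    define y where "y = x - (\<Sum>c\<in>C. ip x c *\<^sub>R c)"
    have S: "(\<Sum>c\<in>C. ip x c *\<^sub>R c) \<in> span C"
      by (intro span_sum span_scale span_base)
    then have "y \<noteq> 0" using x by (auto simp: y_def)
    then have pos: "ip y y > 0" by (rule ip_pos)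
    have "span C \<subseteq> V" using C assms(3) by (simp add: span_minimal)
    then have yV: "y \<in> V" unfolding y_def using x S assms(3) by (blast intro: subspace_diff)
    have orth: "ip y c = 0" if "c \<in> C" for c
      unfolding y_def using ip_orthonormal_sum[of C C c "ip x"] C fin that
      by (simp add: metric_inner_diff_left)
    define z where "z = (1 / sqrt (ip y y)) *\<^sub>R y"
    have zz: "ip z z = 1" using pos by (simp add: z_def metric_inner_bilinear field_simps)
    have zc: "ip z c = 0" if "c \<in> C" for c using orth[OF that] by (simp add: z_def metric_inner_bilinear)
    have "z \<notin> C" using zz zc by force
    moreover have "?P (insert z C)"
    proof (intro conjI)
      have "ip c z = 0" if "c \<in> C" for c using zc[OF that] ip_commute[of c z] by simp
      then show "orthonormal (insert z C)"
        using C zz zc \<open>z \<notin> C\<close> unfolding orthonormal_def by auto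
      show "insert z C \<subseteq> V"
        using C subspace_scale[OF assms(3) yV] by (simp add: z_def)
    qed (use C in blast)
    ultimately show False using max[of "insert z C"] fin by simp
  qed
  moreover have "span C \<subseteq> V" using C assms(3) by (simp add: span_minimal)
  ultimately show thesis using that C by blast
qed

lemma orthonormal_normal_span:
  assumes on: "orthonormal (A \<union> C)" and disj: "A \<inter> C = {}" and span: "span (A \<union> C) = UNIV"
  shows "{v. \<forall>w\<in>span A. ip v w = 0} = span C"
proof (intro Set.equalityI subsetI)
  have fin: "finite (A \<union> C)" using orthonormal_independent[OF on] by (rule independent_imp_finite)
  fix v assume "v \<in> {v. \<forall>w\<in>span A. ip v w = 0}"
  then have "ip v w = 0" if "w \<in> A" for w using that span_base by blast
  then have "(\<Sum>b\<in>A \<union> C. ip v b *\<^sub>R b) = (\<Sum>b\<in>C. ip v b *\<^sub>R b)"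
    using fin by (intro sum.mono_neutral_right) auto
  then have "v = (\<Sum>b\<in>C. ip v b *\<^sub>R b)"
    using orthonormal_expansion[OF on, of v] span by simp
  moreover have "(\<Sum>b\<in>C. ip v b *\<^sub>R b) \<in> span C"
    by (intro span_sum span_scale span_base)
  ultimately show "v \<in> span C" by simp
next
  fix v assume v: "v \<in> span C"
  have CA: "ip c a = 0" if "c \<in> C" "a \<in> A" for a c
    using on disj that unfolding orthonormal_def by (metis UnCI disjoint_iff)
  have vA: "ip v a = 0" if "a \<in> A" for a
    using v by (induction rule: span_induct_alt) (simp_all add: metric_inner_bilinear CA that)
  have "ip v w = 0" if "w \<in> span A" for w
    using that by (induction rule: span_induct_alt) (simp_all add: metric_inner_bilinear vA)
  then show "v \<in> {v. \<forall>w\<in>span A. ip v w = 0}" by blast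
qed

lemma parseval:
  assumes "orthonormal B" "span B = UNIV"
  shows "ip x y = (\<Sum>b\<in>B. ip x b * ip y b)"
proof -
  have "ip x y = ip x (\<Sum>b\<in>B. ip y b *\<^sub>R b)"
    using orthonormal_expansion[of B y] assms by simp
  then show ?thesis by (simp add: metric_inner_bilinear mult.commute)
qed

lemma ip_axis: "ip (axis i 1) (axis j 1) = G $ i $ j"
  by (simp add: metric_inner_eq matrix_vector_mult_basis column_def inner_axis')

text \<open>A Parseval frame of \<open>W\<close> whose members are pairwise orthogonal is an orthonormal basis of \<open>W\<close>
  together with zero vectors: reproducing \<open>N a\<close> itself gives \<open>N a = \<langle>N a, N a\<rangle> N a\<close>.\<close>

lemma orthonormal_basis_of_tight_family:
  assumes fin: "finite I"
    and orth: "\<And>a b. a \<in> I \<Longrightarrow> b \<in> I \<Longrightarrow> a \<noteq> b \<Longrightarrow> ip (N a) (N b) = 0"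
    and mem: "\<And>a. a \<in> I \<Longrightarrow> N a \<in> W" and sub: "subspace W"
    and tight: "\<And>v. v \<in> W \<Longrightarrow> v = (\<Sum>a\<in>I. ip v (N a) *\<^sub>R N a)"
  shows "orthonormal_basis_of G W {a \<in> I. N a \<noteq> 0} N" "card {a \<in> I. N a \<noteq> 0} = dim W"
proof -
  let ?J = "{a \<in> I. N a \<noteq> 0}"
  have unit: "ip (N a) (N a) = 1" if a: "a \<in> ?J" for a
  proof -
    have "N a = (\<Sum>b\<in>I. ip (N a) (N b) *\<^sub>R N b)" using a by (intro tight mem) simp
    also have "\<dots> = (\<Sum>b\<in>I. if b = a then ip (N a) (N a) *\<^sub>R N a else 0)"
      using a orth by (intro sum.cong) auto
    also have "\<dots> = ip (N a) (N a) *\<^sub>R N a" using a fin by simp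
    finally have "(ip (N a) (N a) - 1) *\<^sub>R N a = 0" by (simp add: scaleR_diff_left)
    then show ?thesis using a by simp
  qed
  have on: "ip (N a) (N b) = (if a = b then 1 else 0)" if "a \<in> ?J" "b \<in> ?J" for a b
    using orth unit that by auto
  have inj: "inj_on N ?J"
  proof (rule inj_onI)
    fix a b assume "a \<in> ?J" "b \<in> ?J" "N a = N b"
    then show "a = b" using on[of a b] on[of a a] by (simp split: if_splits)
  qed
  have "orthonormal (N ` ?J)"
    unfolding orthonormal_def
  proof (intro ballI)
    fix y z assume "y \<in> N ` ?J" "z \<in> N ` ?J"
    then obtain a b where "a \<in> ?J" "b \<in> ?J" "y = N a" "z = N b" by blast
    then show "ip y z = (if y = z then 1 else 0)"
      using on[of a b] inj_on_eq_iff[OF inj, of a b] by simp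
  qed
  then have ind: "independent (N ` ?J)" by (rule orthonormal_independent)
  have span: "span (N ` ?J) = W"
  proof (intro Set.equalityI subsetI)
    fix v assume "v \<in> W"
    then have "v = (\<Sum>a\<in>I. ip v (N a) *\<^sub>R N a)" by (rule tight)
    also have "\<dots> = (\<Sum>a\<in>?J. ip v (N a) *\<^sub>R N a)"
      using fin by (intro sum.mono_neutral_right) auto
    also have "\<dots> \<in> span (N ` ?J)" by (intro span_sum span_scale span_base) auto
    finally show "v \<in> span (N ` ?J)" .
  next
    have "N ` ?J \<subseteq> W" using mem by auto
    then have "span (N ` ?J) \<subseteq> W" using sub by (rule span_minimal)
    then show "v \<in> W" if "v \<in> span (N ` ?J)" for v using that by blast
  qed
  show "orthonormal_basis_of G W ?J N"
    unfolding orthonormal_basis_of_def using on ind span by blast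
  show "card ?J = dim W"
    using dim_eq_card_independent[OF ind] card_image[OF inj] span dim_span[of "N ` ?J"] by simp
qed

end

section \<open>Frames adapted to a tangent space\<close>

locale submanifold_frame = pos_def_metric G
  for G :: "'m::{finite,linorder} rmat" +
  fixes e :: "'n::{finite,linorder} \<Rightarrow> 'm rvec" and p :: nat
  assumes inj: "inj e" and indep: "independent (range e)"
    and dim: "CARD('m) = CARD('n) + p" and p: "p \<ge> 1"
begin

definition first_form :: "'n rmat" where
  "first_form = (\<chi> a b. ip (e a) (e b))"

definition normals :: "'m rvec set" where
  "normals = {v. \<forall>w\<in>span (range e). ip v w = 0}"

lemma subspace_normals: "subspace normals"
  by (auto simp: normals_def subspace_def metric_inner_bilinear)

lemma det_first_form_pos: "det first_form > 0"
proof (rule det_pos_if_pos_def)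
  fix v :: "'n rvec" assume v: "v \<noteq> 0"
  define w where "w = (\<Sum>a\<in>UNIV. v $ a *\<^sub>R e a)"
  have "w \<noteq> 0"
  proof
    assume "w = 0"
    then have "(\<Sum>y\<in>range e. v $ inv e y *\<^sub>R y) = 0"
      using inj by (simp add: w_def sum.reindex)
    then have *: "\<forall>y\<in>range e. v $ inv e y = 0"
      using spec[OF conjunct2[OF indep[unfolded independent_explicit]], of "\<lambda>y. v $ inv e y"]
      by blast
    have "v $ a = 0" for a using bspec[OF *, of "e a"] inj by simp
    then show False using v by (simp add: vec_eq_iff)
  qed
  moreover have "v \<bullet> (first_form *v v) = ip w w"
    by (simp add: w_def first_form_def metric_inner_bilinear inner_vec_def matrix_vector_mult_def
        sum_distrib_left mult_ac) (intro sum.cong refl arg_cong2[of _ _ _ _ "(*)"] ip_commute)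
  ultimately show "v \<bullet> (first_form *v v) > 0" by (simp add: ip_pos)
qed

lemma adapted_frame:
  obtains A C where "orthonormal (A \<union> C)" "A \<inter> C = {}" "span (A \<union> C) = UNIV"
    "span A = span (range e)" "card C = p" "card (A \<union> C) = CARD('m)" "finite (A \<union> C)"
proof -
  obtain A where A: "orthonormal A" "span A = span (range e)"
    using orthonormal_extend[of "{}" "span (range e)"] by (auto simp: orthonormal_def)
  obtain B where B: "A \<subseteq> B" "orthonormal B" "span B = UNIV"
    using orthonormal_extend[of A UNIV] A by auto
  have cardA: "card A = CARD('n)"
    using dim_eq_card_independent[OF orthonormal_independent[OF A(1)]]
      dim_eq_card_independent[OF indep] arg_cong[OF A(2), of dim] inj
    by (simp add: card_image)
  have cardB: "card B = CARD('m)"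
    using dim_eq_card_independent[OF orthonormal_independent[OF B(2)]] arg_cong[OF B(3), of dim]
    by simp
  have fin: "finite B" using orthonormal_independent[OF B(2)] by (rule independent_imp_finite)
  have un: "A \<union> B = B" using B by auto
  have "card (B - A) = p"
    using cardA cardB dim B(1) fin by (simp add: card_Diff_subset finite_subset)
  then show thesis
    using that[of A "B - A"] A B cardB fin by (simp add: un)
qed

lemma dim_normals: "dim normals = p"
proof -
  obtain A C where AC: "orthonormal (A \<union> C)" "A \<inter> C = {}" "span (A \<union> C) = UNIV"
    "span A = span (range e)" "card C = p" "card (A \<union> C) = CARD('m)" "finite (A \<union> C)"
    by (rule adapted_frame)
  have "normals = span C"
    using orthonormal_normal_span[OF AC(1-3)] by (simp add: normals_def AC(4))
  moreover have "orthonormal C" using AC(1) by (auto simp: orthonormal_def)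
  ultimately show ?thesis
    using dim_eq_card_independent[OF orthonormal_independent] AC(5) by simp
qed

text \<open>The Gram matrix of orthonormal normal vectors around the tangent frame has the first fundamental form
  as a block and is the identity elsewhere.\<close>

lemma frame_det_squared:
  assumes on: "orthonormal C" and normal: "C \<subseteq> normals"
    and b: "distinct (b # c)" "set (b # c) \<subseteq> C" "length c = p - 1"
  shows "(vdet (b # map e ordered_indices @ c))\<^sup>2 * det G = det first_form"
proof -
  let ?vs = "b # map e ordered_indices @ c"
  have "1 + CARD('n) \<le> CARD('m)" using dim p by simp
  then obtain f :: "'n \<Rightarrow> 'm" where f: "inj f" "\<And>a. place (f a) = 1 + place a"
    "\<And>i. i \<notin> range f \<Longrightarrow> place i < 1 \<or> 1 + CARD('n) \<le> place i"
    by (rule block_embedding) (use that in blast)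
  \<comment> \<open>The place in \<open>b # c\<close> of the row at index \<open>i\<close> outside the tangent block.\<close>
  define \<kappa> :: "'m \<Rightarrow> nat" where "\<kappa> i = (if place i = 0 then 0 else place i - CARD('n))" for i
  have inside: "?vs ! place (f a) = e a" for a
    by (simp add: f nth_append place_less)
  have outside: "?vs ! place i = (b # c) ! \<kappa> i" "\<kappa> i < length (b # c)" if "i \<notin> range f" for i
    using f(3)[OF that] b(3) dim p place_less[of i] by (auto simp: \<kappa>_def nth_append nth_Cons not_less Suc_diff_le split: nat.split)
  have \<kappa>_inj: "i = j" if "i \<notin> range f" "j \<notin> range f" "\<kappa> i = \<kappa> j" for i j
  proof -
    have "place i = place j" using f(3)[OF that(1)] f(3)[OF that(2)] that(3) by (auto simp: \<kappa>_def simp del: place_eq_iff split: if_splits)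
    then show ?thesis by simp
  qed
  have inC: "?vs ! place i \<in> C" if "i \<notin> range f" for i
    using outside[OF that] b(2) nth_mem by (metis subsetD)
  have off: "ip (?vs ! place i) (?vs ! place j) = (if i = j then 1 else 0)" if i: "i \<notin> range f" for i j
  proof (cases "j \<in> range f")
    case True
    then obtain a where a: "j = f a" by blast
    have "ip (?vs ! place i) (e a) = 0"
      using inC[OF i] normal span_base[of "e a" "range e"] unfolding normals_def by blast
    then show ?thesis using i a inside by auto
  next
    case False
    have "?vs ! place i = ?vs ! place j \<longleftrightarrow> i = j"
      using \<kappa>_inj[OF i False] outside[OF i] outside[OF False] b(1) nth_eq_iff_index_eq by metis
    then show ?thesis
      using on inC[OF i] inC[OF False] unfolding orthonormal_def by metis
  qed
  let ?Gram = "(\<chi> i j. ip (?vs ! place i) (?vs ! place j)) :: 'm rmat"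
  have "(vdet ?vs)\<^sup>2 * det G = det ?Gram"
    by (rule vdet_squared_eq_gram)
  also have "\<dots> = det (\<chi> a b. ?Gram $ f a $ f b) * (\<Prod>i\<in>-range f. ?Gram $ i $ i)"
    by (rule det_block) (use f(1) off in auto)
  also have "\<dots> = det first_form"
    using off by (simp only: vec_lambda_beta inside first_form_def) simp
  finally show ?thesis .
qed

text \<open>A tangent vector in \<open>c\<close> would depend linearly on the rows \<open>e\<close>, so \<open>c\<close> consists of normal basis
  vectors; without repetitions among \<open>b\<close> and the \<open>p - 1\<close> entries of \<open>c\<close>, all \<open>p\<close> of them occur.\<close>

lemma frame_det_nonzero:
  assumes span: "span A = span (range e)" and fin: "finite (A \<union> C)" and card: "card C = p"
    and b: "b \<in> C" and c: "set c \<subseteq> A \<union> C" "length c = p - 1"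
    and nz: "vdet (b # map e ordered_indices @ c) \<noteq> 0"
  shows "distinct (b # c)" "set c = C - {b}"
proof -
  let ?vs = "b # map e ordered_indices @ c"
  have len: "length ?vs = CARD('m)" using c dim p by simp
  have "distinct ?vs" using vdet_not_distinct[OF len] nz by blast
  then show dist: "distinct (b # c)" by simp
  have "set c \<inter> A = {}"
  proof (rule ccontr)
    assume "set c \<inter> A \<noteq> {}"
    then obtain k where k: "k < length c" "c ! k \<in> A"
      by (metis Int_iff ex_in_conv in_set_conv_nth)
    let ?k = "1 + CARD('n) + k"
    have "range e \<subseteq> {?vs ! j |j. j < CARD('m) \<and> j \<noteq> ?k}"
    proof
      fix y assume "y \<in> range e"
      then obtain a where "y = e a" by blast
      then have "y = ?vs ! (1 + place a)" by (simp add: nth_append place_less)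
      then show "y \<in> {?vs ! j |j. j < CARD('m) \<and> j \<noteq> ?k}"
        using place_less[of a] dim p by (intro CollectI exI[of _ "1 + place a"]) auto
    qed
    moreover have "?vs ! ?k \<in> span (range e)"
      using k span_base[of "c ! k" A] span by (simp add: nth_append)
    ultimately have "?vs ! ?k \<in> span {?vs ! j |j. j < CARD('m) \<and> j \<noteq> ?k}"
      using span_mono by blast
    then have "vdet ?vs = 0"
      using len k by (intro vdet_zero_if_in_span[of _ ?k]) auto
    then show False using nz by simp
  qed
  then have "set c \<subseteq> C - {b}" using c(1) dist by auto
  moreover have "card (set c) = card (C - {b})"
    using dist c(2) card b fin by (simp add: distinct_card)
  ultimately show "set c = C - {b}" using fin by (intro card_subset_eq) auto
qed

text \<open>A list \<open>c\<close> that contributes has \<open>C - {b}\<close> and \<open>C - {b'}\<close> as its set of entries, which is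
  impossible for \<open>b \<noteq> b'\<close>. For \<open>b = b'\<close> there are \<open>(p - 1)!\<close> such lists, all with the same square.\<close>

lemma sum_frame_dets:
  assumes on: "orthonormal (A \<union> C)" and span: "span A = span (range e)"
    and card: "card C = p" and fin: "finite (A \<union> C)" and normal: "C \<subseteq> normals"
    and b: "b \<in> C" "b' \<in> C"
  shows "(\<Sum>c | set c \<subseteq> A \<union> C \<and> length c = p - 1.
    vdet (b # map e ordered_indices @ c) * vdet (b' # map e ordered_indices @ c)) =
    (if b = b' then fact (p - 1) * (det first_form / det G) else 0)"
proof -
  let ?D = "\<lambda>b c. vdet (b # map e ordered_indices @ c)"
  let ?L = "{c. set c \<subseteq> A \<union> C \<and> length c = p - 1}"
  note nz = frame_det_nonzero[OF span fin card]
  show ?thesis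
  proof (cases "b = b'")
    case False
    have "?D b c * ?D b' c = 0" if "c \<in> ?L" for c
    proof (rule ccontr)
      assume "?D b c * ?D b' c \<noteq> 0"
      then have "set c = C - {b}" "set c = C - {b'}"
        using nz(2)[OF b(1)] nz(2)[OF b(2)] that by auto
      then show False using b False by blast
    qed
    then have "(\<Sum>c\<in>?L. ?D b c * ?D b' c) = 0" by (intro sum.neutral) blast
    then show ?thesis using False by simp
  next
    case True
    let ?K = "{c. length c = p - 1 \<and> distinct c \<and> set c \<subseteq> C - {b}}"
    have finL: "finite ?L" by (rule finite_lists_length_eq[OF fin])
    have "orthonormal C" using on by (auto simp: orthonormal_def)
    note sq = frame_det_squared[OF this normal]
    have "(\<Sum>c\<in>?L. ?D b c * ?D b' c) = (\<Sum>c\<in>?K. det first_form / det G)"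
    proof (rule sum.mono_neutral_cong_right[OF finL])
      show "?K \<subseteq> ?L" by auto
      show "\<forall>c\<in>?L - ?K. ?D b c * ?D b' c = 0"
        using nz[OF b(1)] by fastforce
      show "?D b c * ?D b' c = det first_form / det G" if "c \<in> ?K" for c
      proof -
        have "(?D b c)\<^sup>2 * det G = det first_form"
          by (rule sq) (use that b in auto)
        then show ?thesis using True det_metric_pos by (simp add: power2_eq_square field_simps)
      qed
    qed
    also have "\<dots> = real (card ?K) * (det first_form / det G)" by simp
    also have "card ?K = \<Prod>{card (C - {b}) - (p - 1) + 1 .. card (C - {b})}"
      by (rule card_lists_distinct_length_eq) (use fin card b in auto)
    also have "\<dots> = fact (p - 1)"
      using card b fin by (simp add: fact_prod)
    finally show ?thesis using True by simp
  qed
qed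

end

section \<open>Resolution of normal vectors\<close>

text \<open>A square matrix with orthonormal rows is orthogonal. Index sets, rather than index types, are
  needed because multi-indices and lists of frame vectors are not types of their own. With
  \<open>R = F\<^sup>T F\<close> one has \<open>tr R = card I\<close> and \<open>tr (R\<^sup>T R) = tr (F F\<^sup>T F F\<^sup>T) = card I\<close>, so the squared
  Frobenius norm of \<open>R - 1\<close> is \<open>card I - 2 card I + card J = 0\<close>.\<close>

lemma orthonormal_rows_imp_columns:
  fixes F :: "'a \<Rightarrow> 'b \<Rightarrow> real"
  assumes fin: "finite I" "finite J" and card: "card I = card J"
    and rows: "\<And>a b. a \<in> I \<Longrightarrow> b \<in> I \<Longrightarrow> (\<Sum>c\<in>J. F a c * F b c) = (if a = b then 1 else 0)"
    and cd: "c \<in> J" "d \<in> J"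
  shows "(\<Sum>a\<in>I. F a c * F a d) = (if c = d then 1 else 0)"
proof -
  define R where "R c d = (\<Sum>a\<in>I. F a c * F a d)" for c d
  define \<delta> :: "'b \<Rightarrow> 'b \<Rightarrow> real" where "\<delta> c d = (if c = d then 1 else 0)" for c d
  have trace: "(\<Sum>c\<in>J. R c c) = card I"
  proof -
    have "(\<Sum>c\<in>J. R c c) = (\<Sum>a\<in>I. \<Sum>c\<in>J. F a c * F a c)"
      unfolding R_def by (rule sum.swap)
    then show ?thesis by (simp add: rows)
  qed
  have "(\<Sum>c\<in>J. \<Sum>d\<in>J. (R c d)\<^sup>2) =
    (\<Sum>c\<in>J. \<Sum>d\<in>J. \<Sum>a\<in>I. \<Sum>b\<in>I. (F a c * F b c) * (F a d * F b d))"
    unfolding R_def by (simp add: power2_eq_square sum_product mult_ac)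
  also have "\<dots> = (\<Sum>c\<in>J. \<Sum>a\<in>I. \<Sum>d\<in>J. \<Sum>b\<in>I. (F a c * F b c) * (F a d * F b d))"
    by (intro sum.cong refl sum.swap)
  also have "\<dots> = (\<Sum>a\<in>I. \<Sum>c\<in>J. \<Sum>d\<in>J. \<Sum>b\<in>I. (F a c * F b c) * (F a d * F b d))"
    by (rule sum.swap)
  also have "\<dots> = (\<Sum>a\<in>I. \<Sum>c\<in>J. \<Sum>b\<in>I. \<Sum>d\<in>J. (F a c * F b c) * (F a d * F b d))"
    by (intro sum.cong refl sum.swap)
  also have "\<dots> = (\<Sum>a\<in>I. \<Sum>b\<in>I. \<Sum>c\<in>J. \<Sum>d\<in>J. (F a c * F b c) * (F a d * F b d))"
    by (intro sum.cong refl sum.swap)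
  also have "\<dots> = (\<Sum>a\<in>I. \<Sum>b\<in>I. (\<Sum>c\<in>J. F a c * F b c) * (\<Sum>d\<in>J. F a d * F b d))"
    by (simp add: sum_product)
  also have "\<dots> = (\<Sum>a\<in>I. \<Sum>b\<in>I. if a = b then 1 else 0)"
    by (intro sum.cong refl) (simp add: rows)
  also have "\<dots> = card I"
    using fin by simp
  finally have square: "(\<Sum>c\<in>J. \<Sum>d\<in>J. (R c d)\<^sup>2) = card I" .
  have "(\<Sum>c\<in>J. \<Sum>d\<in>J. (R c d - \<delta> c d)\<^sup>2) =
    (\<Sum>c\<in>J. \<Sum>d\<in>J. (R c d)\<^sup>2) - 2 * (\<Sum>c\<in>J. \<Sum>d\<in>J. R c d * \<delta> c d) + (\<Sum>c\<in>J. \<Sum>d\<in>J. \<delta> c d * \<delta> c d)"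
  proof -
    have "(R c d - \<delta> c d)\<^sup>2 = (R c d)\<^sup>2 - 2 * (R c d * \<delta> c d) + \<delta> c d * \<delta> c d" for c d
      by (simp add: power2_eq_square algebra_simps)
    then show ?thesis by (simp add: sum.distrib sum_subtractf sum_distrib_left)
  qed
  also have "\<dots> = 0"
  proof -
    have diag: "(\<Sum>d\<in>J. f d * \<delta> c d) = f c" if "c \<in> J" for f and c
    proof -
      have "(\<Sum>d\<in>J. f d * \<delta> c d) = (\<Sum>d\<in>J. if d = c then f c else 0)"
        by (intro sum.cong) (auto simp: \<delta>_def)
      then show ?thesis using fin that by simp
    qed
    have "(\<Sum>c\<in>J. \<Sum>d\<in>J. R c d * \<delta> c d) = card I"
      unfolding trace[symmetric] by (intro sum.cong refl diag)
    moreover have "(\<Sum>c\<in>J. \<Sum>d\<in>J. \<delta> c d * \<delta> c d) = (\<Sum>c\<in>J. \<delta> c c)"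
      by (intro sum.cong refl diag)
    ultimately show ?thesis using card by (simp add: square \<delta>_def)
  qed
  finally have "(\<Sum>c\<in>J. \<Sum>d\<in>J. (R c d - \<delta> c d)\<^sup>2) = 0" .
  then have "(R c d - \<delta> c d)\<^sup>2 = 0"
    using fin cd by (simp add: sum_nonneg_eq_0_iff sum_nonneg)
  then show ?thesis by (simp add: R_def \<delta>_def)
qed

text \<open>The family \<open>Z\<close> enters only through the determinant formula, which determines it on
  multi-indices because the form is non-degenerate.\<close>

locale normal_generators = submanifold_frame G e p
  for G :: "'m::{finite,linorder} rmat" and e :: "'n::{finite,linorder} \<Rightarrow> 'm rvec" and p +
  fixes Z :: "'m list \<Rightarrow> 'm rvec"
  assumes inner_Z: "length \<alpha> = p - 1 \<Longrightarrow> ip v (Z \<alpha>) =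
    sqrt (det G) / (sqrt (det first_form) * sqrt (fact (p - 1))) *
    vdet (v # map e ordered_indices @ map (\<lambda>i. axis i 1) \<alpha>)"
begin

text \<open>The multilinear extension of \<open>Z\<close> from coordinate vectors to arbitrary vectors.\<close>

definition Z_at :: "'m rvec list \<Rightarrow> 'm rvec" where
  "Z_at c = (\<Sum>\<alpha>\<in>multi_indices p. (\<Prod>k<p - 1. c ! k $ (\<alpha> ! k)) *\<^sub>R Z \<alpha>)"

lemma inner_Z_at:
  assumes "length c = p - 1"
  shows "ip v (Z_at c) = sqrt (det G) / (sqrt (det first_form) * sqrt (fact (p - 1))) *
    vdet (v # map e ordered_indices @ c)"
proof -
  have "vdet (v # map e ordered_indices @ c) = (\<Sum>\<alpha>\<in>multi_indices p.
    vdet (v # map e ordered_indices @ map (\<lambda>i. axis i 1) \<alpha>) * (\<Prod>k<p - 1. c ! k $ (\<alpha> ! k)))"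
    using vdet_expand_block[of "v # map e ordered_indices" c "[]"] assms dim p
    by (simp add: multi_indices_def)
  then show ?thesis
    by (simp add: Z_at_def metric_inner_bilinear sum_distrib_left)
      (intro sum.cong refl, simp add: inner_Z multi_indices_def)
qed

text \<open>Pairing with \<open>e a\<close> repeats a row of the determinant.\<close>

lemma Z_normal:
  assumes "\<alpha> \<in> multi_indices p"
  shows "Z \<alpha> \<in> normals"
proof -
  have tangent: "ip (e a) (Z \<alpha>) = 0" for a
  proof -
    have "map e ordered_indices ! place a = e a" by (simp add: place_less)
    then have "e a \<in> set (map e ordered_indices)"
      by (metis length_map length_ordered_indices nth_mem place_less)
    then have "vdet (e a # map e ordered_indices @ map (\<lambda>i. axis i 1) \<alpha>) = 0"
      by (intro vdet_not_distinct) (use assms dim p in \<open>auto simp: multi_indices_def\<close>)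
    then show ?thesis using assms by (simp add: inner_Z multi_indices_def)
  qed
  have "ip w (Z \<alpha>) = 0" if "w \<in> span (range e)" for w
    using that by (induction rule: span_induct_alt) (auto simp: metric_inner_bilinear tangent)
  then show ?thesis by (simp add: normals_def ip_commute[of "Z \<alpha>"])
qed

lemma Z_at_normal: "Z_at c \<in> normals"
  unfolding Z_at_def using Z_normal subspace_normals by (intro subspace_sum subspace_scale)

text \<open>The right-hand side is a linear map \<open>Q\<close> into the normal space. Its matrix with respect to the
  normal basis \<open>C\<close> is the identity, since the constant in the determinant formula is exactly the one
  that normalises \<open>sum_frame_dets\<close>.\<close>

lemma resolution_of_normals:
  assumes on: "orthonormal (A \<union> C)" and disj: "A \<inter> C = {}" and sUN: "span (A \<union> C) = UNIV"
    and sA: "span A = span (range e)" and card: "card C = p" and fin: "finite (A \<union> C)"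
    and v: "v \<in> normals"
  shows "v = (\<Sum>c | set c \<subseteq> A \<union> C \<and> length c = p - 1. ip v (Z_at c) *\<^sub>R Z_at c)"
proof -
  let ?L = "{c. set c \<subseteq> A \<union> C \<and> length c = p - 1}"
  define Q where "Q v = (\<Sum>c\<in>?L. ip v (Z_at c) *\<^sub>R Z_at c)" for v
  have span_C: "normals = span C"
    using orthonormal_normal_span[OF on disj sUN] by (simp add: normals_def sA)
  have on_C: "orthonormal C" using on by (auto simp: orthonormal_def)
  have matrix: "ip (Q b) b' = (if b = b' then 1 else 0)" if b: "b \<in> C" "b' \<in> C" for b b'
  proof -
    define K where "K = sqrt (det G) / (sqrt (det first_form) * sqrt (fact (p - 1)))"
    have K: "ip v (Z_at c) = K * vdet (v # map e ordered_indices @ c)" if "c \<in> ?L" for v c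
      using that by (simp add: inner_Z_at K_def)
    have "ip (Q b) b' = (\<Sum>c\<in>?L. ip b (Z_at c) * ip b' (Z_at c))"
      by (simp add: Q_def metric_inner_bilinear ip_commute)
    also have "\<dots> = K\<^sup>2 * (\<Sum>c\<in>?L. vdet (b # map e ordered_indices @ c) * vdet (b' # map e ordered_indices @ c))"
      unfolding sum_distrib_left
      by (intro sum.cong refl) (simp add: K power2_eq_square mult_ac)
    also have "\<dots> = K\<^sup>2 * (if b = b' then fact (p - 1) * (det first_form / det G) else 0)"
      by (subst sum_frame_dets[OF on sA card fin _ b]) (use span_C span_base in auto)
    also have "\<dots> = (if b = b' then 1 else 0)"
      using det_metric_pos det_first_form_pos
      by (simp add: K_def power_divide power_mult_distrib)
    finally show ?thesis .
  qed
  have Q_normal: "Q v \<in> normals" for v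
    unfolding Q_def using Z_at_normal subspace_normals by (intro subspace_sum subspace_scale)
  have Q_C: "Q b = b" if b: "b \<in> C" for b
  proof -
    have "Q b = (\<Sum>b'\<in>C. ip (Q b) b' *\<^sub>R b')"
      using orthonormal_expansion[OF on_C] Q_normal span_C by blast
    also have "\<dots> = (\<Sum>b'\<in>C. if b' = b then b' else 0)"
      by (intro sum.cong refl) (simp add: matrix b)
    also have "\<dots> = b" using fin b by simp
    finally show ?thesis .
  qed
  have "Q v = v"
    using v[unfolded span_C]
  proof (induction rule: span_induct_alt)
    case (step r b w)
    have "Q (r *\<^sub>R b + w) = r *\<^sub>R Q b + Q w"
      by (simp add: Q_def metric_inner_bilinear scaleR_add_left sum.distrib scaleR_sum_right)
    then show ?case using step Q_C by simp
  qed (simp add: Q_def metric_inner_bilinear)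
  then show ?thesis by (simp add: Q_def)
qed

section \<open>The vectors obtained from an orthonormal eigenbasis\<close>

definition combination :: "('m list \<Rightarrow> real) \<Rightarrow> 'm rvec" where
  "combination f = (\<Sum>\<beta>\<in>multi_indices p. f \<beta> *\<^sub>R Z \<beta>)"

lemma combination_normal: "combination f \<in> normals"
  unfolding combination_def using Z_normal subspace_normals by (intro subspace_sum subspace_scale)

text \<open>The eigenvector equation says that \<open>N = combination (E a)\<close> satisfies \<open>\<langle>N, Z\<^sup>\<beta>\<rangle> = \<mu> E a \<beta>\<close>.
  Lowering the index and contracting with \<open>E b\<close> turns this into
  \<open>\<langle>N, combination (E b)\<rangle> = \<mu> \<langle>E b, E a\<rangle>\<close>, where the last bracket is that of multi-vectors.\<close>

lemma combination_orthogonal: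
  assumes onE: "multi_orthonormal p G E"
    and eig: "\<And>\<beta>. \<beta> \<in> multi_indices p \<Longrightarrow> (\<Sum>\<alpha>\<in>multi_indices p.
      ip (Z \<alpha>) (\<Sum>\<delta>\<in>multi_indices p. multi_metric (matrix_inv G) \<beta> \<delta> *\<^sub>R Z \<delta>) * E a \<alpha>) = \<mu> * E a \<beta>"
    and ab: "a \<in> multi_indices p" "b \<in> multi_indices p" "a \<noteq> b"
  shows "ip (combination (E a)) (combination (E b)) = 0"
proof -
  let ?I = "multi_indices p :: 'm list set"
  define Zu where "Zu \<beta> = (\<Sum>\<delta>\<in>?I. multi_metric (matrix_inv G) \<beta> \<delta> *\<^sub>R Z \<delta>)" for \<beta>
  have lower: "Z \<sigma> = (\<Sum>\<beta>\<in>?I. multi_metric G \<sigma> \<beta> *\<^sub>R Zu \<beta>)" if "\<sigma> \<in> ?I" for \<sigma>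
  proof -
    have "(\<Sum>\<beta>\<in>?I. multi_metric G \<sigma> \<beta> *\<^sub>R Zu \<beta>) =
      (\<Sum>\<beta>\<in>?I. \<Sum>\<delta>\<in>?I. (multi_metric G \<sigma> \<beta> * multi_metric (matrix_inv G) \<beta> \<delta>) *\<^sub>R Z \<delta>)"
      by (simp add: Zu_def scaleR_sum_right)
    also have "\<dots> = (\<Sum>\<delta>\<in>?I. (\<Sum>\<beta>\<in>?I. multi_metric G \<sigma> \<beta> * multi_metric (matrix_inv G) \<beta> \<delta>) *\<^sub>R Z \<delta>)"
      unfolding scaleR_sum_left by (rule sum.swap)
    also have "\<dots> = (\<Sum>\<delta>\<in>?I. if \<delta> = \<sigma> then Z \<delta> else 0)"
      by (intro sum.cong refl) (simp add: multi_metric_inverse[OF invertible_metric that])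
    also have "\<dots> = Z \<sigma>" using that by (simp add: multi_indices_finite)
    finally show ?thesis by simp
  qed
  have eig': "ip (combination (E a)) (Zu \<beta>) = \<mu> * E a \<beta>" if "\<beta> \<in> ?I" for \<beta>
    using eig[OF that] by (simp add: combination_def metric_inner_bilinear Zu_def[symmetric] mult.commute)
  have "ip (combination (E a)) (combination (E b)) =
    (\<Sum>\<sigma>\<in>?I. E b \<sigma> * (\<Sum>\<beta>\<in>?I. multi_metric G \<sigma> \<beta> * ip (combination (E a)) (Zu \<beta>)))"
    unfolding combination_def[of "E b"] metric_inner_sum_right metric_inner_scaleR_right
    by (intro sum.cong refl) (subst lower, simp_all add: metric_inner_bilinear)
  also have "\<dots> = \<mu> * (\<Sum>\<sigma>\<in>?I. \<Sum>\<beta>\<in>?I. multi_metric G \<sigma> \<beta> * E b \<sigma> * E a \<beta>)"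
    unfolding sum_distrib_left by (intro sum.cong refl) (simp add: eig' mult_ac)
  also have "\<dots> = 0"
    using onE ab unfolding multi_orthonormal_def by simp
  finally show ?thesis .
qed

text \<open>The coordinates \<open>F a c\<close> of \<open>E a\<close> in an orthonormal basis of multi-vectors have orthonormal rows,
  by Parseval in every slot, and there are as many lists \<open>c\<close> as multi-indices. So the columns are
  orthonormal as well, and replacing the vectors \<open>Z_at c\<close> by the vectors
  \<open>combination (E a) = \<Sum>\<^sub>c F a c Z_at c\<close> leaves \<open>\<Sum>\<^sub>c \<langle>v, Z_at c\<rangle> Z_at c\<close> unchanged.\<close>

lemma combination_tight:
  assumes onE: "multi_orthonormal p G E" and v: "v \<in> normals"
  shows "v = (\<Sum>a\<in>multi_indices p. ip v (combination (E a)) *\<^sub>R combination (E a))"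
proof -
  let ?I = "multi_indices p :: 'm list set"
  obtain A C where AC: "orthonormal (A \<union> C)" "A \<inter> C = {}" "span (A \<union> C) = UNIV"
    "span A = span (range e)" "card C = p" "card (A \<union> C) = CARD('m)" "finite (A \<union> C)"
    by (rule adapted_frame)
  let ?B = "A \<union> C"
  let ?L = "{c. set c \<subseteq> ?B \<and> length c = p - 1}"
  have finL: "finite ?L" by (rule finite_lists_length_eq[OF AC(7)])
  have "card ?L = card ?I"
    using card_lists_length_eq[OF AC(7), of "p - 1"] card_lists_length_eq[of "UNIV :: 'm set" "p - 1"]
    by (simp add: AC(6) multi_indices_def)
  note card = this[symmetric]
  define F where "F a c = (\<Sum>\<beta>\<in>?I. E a \<beta> * (\<Prod>k<p - 1. ip (axis (\<beta> ! k) 1) (c ! k)))" for a c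
  have gram: "(\<Sum>c\<in>?L. (\<Prod>k<p - 1. ip (axis (\<beta> ! k) 1) (c ! k)) *
      (\<Prod>k<p - 1. ip (axis (\<beta>' ! k) 1) (c ! k))) = multi_metric G \<beta> \<beta>'"
    if "\<beta> \<in> ?I" for \<beta> \<beta>'
  proof -
    have "(\<Sum>c\<in>?L. (\<Prod>k<p - 1. ip (axis (\<beta> ! k) 1) (c ! k)) *
        (\<Prod>k<p - 1. ip (axis (\<beta>' ! k) 1) (c ! k))) =
      (\<Prod>k<p - 1. \<Sum>b\<in>?B. ip (axis (\<beta> ! k) 1) b * ip (axis (\<beta>' ! k) 1) b)"
      unfolding prod_sum_lists by (simp add: prod.distrib)
    also have "\<dots> = (\<Prod>k<p - 1. G $ (\<beta> ! k) $ (\<beta>' ! k))"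
      by (simp add: parseval[OF AC(1,3), symmetric] ip_axis)
    finally show ?thesis using that by (simp add: multi_metric_def multi_indices_def)
  qed
  have rows: "(\<Sum>c\<in>?L. F a c * F b c) = (if a = b then 1 else 0)" if "a \<in> ?I" "b \<in> ?I" for a b
  proof -
    define w where "w \<beta> c = (\<Prod>k<p - 1. ip (axis (\<beta> ! k) 1) (c ! k))" for \<beta> c
    have "(\<Sum>c\<in>?L. F a c * F b c) =
      (\<Sum>c\<in>?L. \<Sum>\<beta>\<in>?I. \<Sum>\<beta>'\<in>?I. E a \<beta> * E b \<beta>' * (w \<beta> c * w \<beta>' c))"
      unfolding F_def w_def[symmetric] sum_product by (intro sum.cong refl) simp
    also have "\<dots> = (\<Sum>\<beta>\<in>?I. \<Sum>c\<in>?L. \<Sum>\<beta>'\<in>?I. E a \<beta> * E b \<beta>' * (w \<beta> c * w \<beta>' c))"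
      by (rule sum.swap)
    also have "\<dots> = (\<Sum>\<beta>\<in>?I. \<Sum>\<beta>'\<in>?I. \<Sum>c\<in>?L. E a \<beta> * E b \<beta>' * (w \<beta> c * w \<beta>' c))"
      by (intro sum.cong refl sum.swap)
    also have "\<dots> = (\<Sum>\<beta>\<in>?I. \<Sum>\<beta>'\<in>?I. multi_metric G \<beta> \<beta>' * E a \<beta> * E b \<beta>')"
      unfolding sum_distrib_left[symmetric] w_def
      by (intro sum.cong refl) (subst gram, simp_all)
    also have "\<dots> = (if a = b then 1 else 0)"
      using onE that by (simp add: multi_orthonormal_def)
    finally show ?thesis .
  qed
  have columns: "(\<Sum>a\<in>?I. F a c * F a d) = (if c = d then 1 else 0)" if "c \<in> ?L" "d \<in> ?L" for c d
    by (rule orthonormal_rows_imp_columns[OF multi_indices_finite finL card rows that])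
  have comb: "combination (E a) = (\<Sum>c\<in>?L. F a c *\<^sub>R Z_at c)" for a
  proof -
    define w where "w \<beta> c = (\<Prod>k<p - 1. ip (axis (\<beta> ! k) 1) (c ! k))" for \<beta> c
    define y where "y c \<delta> = (\<Prod>k<p - 1. c ! k $ (\<delta> ! k))" for c :: "'m rvec list" and \<delta> :: "'m list"
    have wy: "(\<Sum>c\<in>?L. w \<beta> c * y c \<delta>) = (if \<beta> = \<delta> then 1 else 0)" if "\<beta> \<in> ?I" "\<delta> \<in> ?I" for \<beta> \<delta>
    proof -
      have "(\<Sum>c\<in>?L. w \<beta> c * y c \<delta>) =
        (\<Prod>k<p - 1. \<Sum>b\<in>?B. ip (axis (\<beta> ! k) 1) b * b $ (\<delta> ! k))"
        unfolding prod_sum_lists w_def y_def by (simp add: prod.distrib)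
      also have "\<dots> = (\<Prod>k<p - 1. (\<Sum>b\<in>?B. ip (axis (\<beta> ! k) 1) b *\<^sub>R b) $ (\<delta> ! k))"
        by simp
      also have "\<dots> = (\<Prod>k<p - 1. if \<beta> ! k = \<delta> ! k then 1 else 0)"
        by (intro prod.cong refl, subst orthonormal_expansion[OF AC(1), symmetric])
          (auto simp: AC(3) axis_def)
      also have "\<dots> = (if \<beta> = \<delta> then 1 else 0)"
        by (rule prod_kronecker_lists) (use that in \<open>auto simp: multi_indices_def\<close>)
      finally show ?thesis .
    qed
    have "(\<Sum>c\<in>?L. F a c *\<^sub>R Z_at c) =
      (\<Sum>c\<in>?L. \<Sum>\<beta>\<in>?I. \<Sum>\<delta>\<in>?I. (E a \<beta> * (w \<beta> c * y c \<delta>)) *\<^sub>R Z \<delta>)"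
      unfolding F_def Z_at_def w_def[symmetric] y_def[symmetric] scaleR_sum_left
      by (simp add: scaleR_sum_right mult_ac)
    also have "\<dots> = (\<Sum>\<beta>\<in>?I. \<Sum>c\<in>?L. \<Sum>\<delta>\<in>?I. (E a \<beta> * (w \<beta> c * y c \<delta>)) *\<^sub>R Z \<delta>)"
      by (rule sum.swap)
    also have "\<dots> = (\<Sum>\<beta>\<in>?I. \<Sum>\<delta>\<in>?I. \<Sum>c\<in>?L. (E a \<beta> * (w \<beta> c * y c \<delta>)) *\<^sub>R Z \<delta>)"
      by (intro sum.cong refl sum.swap)
    also have "\<dots> = (\<Sum>\<beta>\<in>?I. \<Sum>\<delta>\<in>?I. (E a \<beta> * (\<Sum>c\<in>?L. w \<beta> c * y c \<delta>)) *\<^sub>R Z \<delta>)"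
      by (simp add: sum_distrib_left scaleR_sum_left)
    also have "\<dots> = (\<Sum>\<beta>\<in>?I. \<Sum>\<delta>\<in>?I. if \<delta> = \<beta> then E a \<beta> *\<^sub>R Z \<beta> else 0)"
      by (intro sum.cong refl) (subst wy, auto)
    also have "\<dots> = combination (E a)"
      by (simp add: combination_def multi_indices_finite)
    finally show ?thesis by simp
  qed
  have "(\<Sum>a\<in>?I. ip v (combination (E a)) *\<^sub>R combination (E a)) =
    (\<Sum>a\<in>?I. \<Sum>c\<in>?L. \<Sum>d\<in>?L. (ip v (Z_at c) * (F a c * F a d)) *\<^sub>R Z_at d)"
    unfolding comb metric_inner_sum_right metric_inner_scaleR_right scaleR_sum_left
    by (simp add: scaleR_sum_right mult_ac)
  also have "\<dots> = (\<Sum>c\<in>?L. \<Sum>a\<in>?I. \<Sum>d\<in>?L. (ip v (Z_at c) * (F a c * F a d)) *\<^sub>R Z_at d)"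
    by (rule sum.swap)
  also have "\<dots> = (\<Sum>c\<in>?L. \<Sum>d\<in>?L. \<Sum>a\<in>?I. (ip v (Z_at c) * (F a c * F a d)) *\<^sub>R Z_at d)"
    by (intro sum.cong refl sum.swap)
  also have "\<dots> = (\<Sum>c\<in>?L. \<Sum>d\<in>?L. (ip v (Z_at c) * (\<Sum>a\<in>?I. F a c * F a d)) *\<^sub>R Z_at d)"
    by (simp add: sum_distrib_left scaleR_sum_left)
  also have "\<dots> = (\<Sum>c\<in>?L. \<Sum>d\<in>?L. if d = c then ip v (Z_at c) *\<^sub>R Z_at c else 0)"
    by (intro sum.cong refl) (subst columns, auto)
  also have "\<dots> = (\<Sum>c\<in>?L. ip v (Z_at c) *\<^sub>R Z_at c)"
    using finL by simp
  also have "\<dots> = v"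
    by (rule resolution_of_normals[OF AC(1-5,7) v, symmetric])
  finally show ?thesis by simp
qed

lemma normal_frame:
  assumes onE: "multi_orthonormal p G E"
    and eig: "\<And>a. a \<in> multi_indices p \<Longrightarrow> multi_eigenvector p (\<lambda>\<alpha> \<beta>. ip (Z \<alpha>)
      (\<Sum>\<delta>\<in>multi_indices p. multi_metric (matrix_inv G) \<beta> \<delta> *\<^sub>R Z \<delta>)) (E a)"
  shows "card {a \<in> multi_indices p. combination (E a) \<noteq> 0} = p"
    and "orthonormal_basis_of G normals {a \<in> multi_indices p. combination (E a) \<noteq> 0}
      (\<lambda>a. combination (E a))"
proof -
  have orth: "ip (combination (E a)) (combination (E b)) = 0"
    if "a \<in> multi_indices p" "b \<in> multi_indices p" "a \<noteq> b" for a b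
    using eig[OF that(1)] combination_orthogonal[OF onE _ that] unfolding multi_eigenvector_def by blast
  note basis = orthonormal_basis_of_tight_family[OF multi_indices_finite orth
    combination_normal subspace_normals combination_tight[OF onE]]
  show "card {a \<in> multi_indices p. combination (E a) \<noteq> 0} = p"
    using basis(2) by (simp add: dim_normals)
  show "orthonormal_basis_of G normals {a \<in> multi_indices p. combination (E a) \<noteq> 0}
      (\<lambda>a. combination (E a))"
    by (rule basis(1))
qed

end

section \<open>The normal frame of an embedded submanifold\<close>

lemma frame_eq_derivative:
  assumes "x differentiable (at u)"
  shows "frame x u a = frechet_derivative x (at u) (axis a 1)"
proof -
  have "((\<lambda>u. x u $ i) has_derivative (\<lambda>h. frechet_derivative x (at u) h $ i)) (at u)" for i
    using assms
    by (intro bounded_linear.has_derivative[OF bounded_linear_vec_nth])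
      (simp add: frechet_derivative_works)
  note component = frechet_derivative_at[OF this, symmetric]
  show ?thesis
    unfolding frame_def partial_def component by simp
qed

lemma frame_independent:
  assumes diff: "x differentiable (at u)" and inj: "inj (frechet_derivative x (at u))"
  shows "inj (frame x u)" "independent (range (frame x u))"
proof -
  let ?D = "frechet_derivative x (at u)"
  have lin: "linear ?D" using diff by (rule linear_frechet_derivative)
  have fr: "frame x u = (\<lambda>a. ?D (axis a 1))"
    using frame_eq_derivative[OF diff] by blast
  show "inj (frame x u)"
    unfolding fr using inj by (auto intro!: injI simp: axis_eq_axis dest: injD)
  have "independent (range (\<lambda>a. axis a 1) :: 'a rvec set)"
    by (rule independent_mono[OF independent_Basis]) (auto simp: Basis_vec_def)
  then have "independent (?D ` range (\<lambda>a. axis a 1))"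
    by (rule linear_independent_injective_image[OF lin]) (use inj in \<open>auto intro: inj_on_subset\<close>)
  then show "independent (range (frame x u))"
    unfolding fr by (simp add: image_image)
qed

theorem mainTheorem4:
  fixes M :: "'a topology" and \<A> :: "('a, 'm::{finite,linorder}) chart set"
    and h :: "('a, 'm) chart \<Rightarrow> 'm rvec \<Rightarrow> 'm rmat"
    and S :: "'b topology" and \<B> :: "('b, 'n::{finite,linorder}) chart set"
    and \<iota> :: "'b \<Rightarrow> 'a" and \<rho> :: "('b, 'n) chart \<Rightarrow> 'n rvec \<Rightarrow> real"
    and p :: nat and q :: 'b and c :: "('b, 'n) chart" and d :: "('a, 'm) chart"
    and x :: "'n rvec \<Rightarrow> 'm rvec" and u :: "'n rvec" and G :: "'m rmat"
    and E :: "'m list \<Rightarrow> 'm list \<Rightarrow> real"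
  assumes "CARD('n) \<ge> 2" and "p \<ge> 1" and "CARD('m) = CARD('n) + p"
    and "smooth_manifold M \<A>" and "riemannian_metric \<A> h"
    and "smooth_manifold S \<B>" and "smooth_embedding S \<B> M \<A> \<iota>"
    and "nonvanishing_density \<B> \<rho>"
    and "c \<in> \<B>" and "d \<in> \<A>" and "q \<in> dom_chart c" and "\<iota> q \<in> dom_chart d"
    and "x = local_rep \<iota> c d" and "u = coords c q" and "G = h d (coords d (\<iota> q))"
    and "multi_orthonormal p G E"
    and "\<And>\<alpha>. \<alpha> \<in> multi_indices p \<Longrightarrow> multi_eigenvector p (Z_matrix p G x (\<rho> c) u) (E \<alpha>)"
  shows "card {\<alpha> \<in> multi_indices p. N_hat p G x (\<rho> c) u E \<alpha> \<noteq> 0} = p \<and>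
    orthonormal_basis_of G (normal_vectors G x u)
      {\<alpha> \<in> multi_indices p. N_hat p G x (\<rho> c) u E \<alpha> \<noteq> 0} (N_hat p G x (\<rho> c) u E)"
proof -
  have "coords d (\<iota> q) \<in> coords d ` dom_chart d" using assms(12) by blast
  then have G: "transpose G = G" "\<And>v. v \<noteq> 0 \<Longrightarrow> v \<bullet> (G *v v) > 0"
    using assms(5,10,15) unfolding riemannian_metric_def by blast+
  define U where "U = coords c ` {q \<in> dom_chart c. \<iota> q \<in> dom_chart d}"
  have u: "u \<in> U" using assms(11,12,14) by (auto simp: U_def)
  have emb: "smooth_on U x" "\<forall>u\<in>U. inj (frechet_derivative x (at u))"
    using assms(7,9,10,13) unfolding smooth_embedding_def Let_def U_def by blast+
  have "Ck_on (Suc 0) U x" using emb(1) unfolding smooth_on_def by blast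
  then have diff: "x differentiable (at u)" using u by simp
  have r: "\<rho> c u \<noteq> 0"
    using assms(8,9,11,14) unfolding nonvanishing_density_def by blast
  interpret submanifold_frame G "frame x u" p
    using G frame_independent[OF diff] emb(2) u assms(2,3) by unfold_locales auto
  have first: "induced_metric G x u = first_form"
    by (simp add: induced_metric_def first_form_def)
  interpret normal_generators G "frame x u" p "Z_lower p G x (\<rho> c) u"
    by unfold_locales
      (rule metric_inner_Z_lower[where r = "\<rho> c" and u = u and x = x, OF invertible_metric r assms(3,2), unfolded first])
  have N: "N_hat p G x (\<rho> c) u E = (\<lambda>\<alpha>. combination (E \<alpha>))"
    by (simp add: fun_eq_iff N_hat_def combination_def)
  have normals: "normal_vectors G x u = normals"
    by (simp add: normal_vectors_def normals_def tangent_space_def)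
  have matrix: "Z_matrix p G x (\<rho> c) u = (\<lambda>\<alpha> \<beta>. ip (Z_lower p G x (\<rho> c) u \<alpha>)
      (\<Sum>\<delta>\<in>multi_indices p. multi_metric (matrix_inv G) \<beta> \<delta> *\<^sub>R Z_lower p G x (\<rho> c) u \<delta>))"
    by (simp add: fun_eq_iff Z_matrix_def Z_upper_def)
  show ?thesis
    unfolding N normals using normal_frame[OF assms(16) assms(17)[unfolded matrix]] by blast
qed

end
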